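(* For every $\lambda\in kG$, the associated graded algebra of $H_\lambda$ is $\operatorname{gr}H_\lambda=H_0=k[x,y]\rtimes G$.
   Context: Let $p$ be an odd prime, $k$ an algebraically closed field of characteristic $p$, and $G=\langle g\rangle$ the cyclic group of order $p$ generated by $g=\begin{pmatrix}1&1\\0&1\end{pmatrix}\in \mathrm{SL}(2,p)$. $G$ acts on the free algebra $k\langle x,y\rangle$ by algebra automorphisms with $g\cdot x=x$, $g\cdot y=x+y$, and $k\langle x,y\rangle\rtimes G$ is the smash product (so $gf=(g\cdot f)g$). For $\lambda\in kG$ set $H_\lambda=(k\langle x,y\rangle\rtimes G)/(xy-yx-\lambda)$; in particular $H_0=k[x,y]\rtimes G$. $H_\lambda$ is filtered by putting $x,y$ in degree $1$ and $G$ in degree $0$; $\operatorname{gr}H_\lambda$ is the associated graded algebra, and equality with $H_0$ means that the natural graded surjection $H_0\to\operatorname{gr}H_\lambda$ is an isomorphism. *)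

theory Defs
  imports
    "HOL-Analysis.Determinants"
    "HOL-Library.Poly_Mapping"
    "HOL-Computational_Algebra.Computational_Algebra"
    "HOL-Algebra.Product_Groups"
    "HOL-Algebra.QuotRing"
begin

section \<open>Graded algebras and the associated graded algebra of a filtration\<close>

text \<open>
  The field of scalars is a type \<open>'k\<close>; a \<open>'k\<close>-algebra structure on a ring is recorded by its
  structure map \<open>scalar\<close>, i.e. \<open>c\<close> is sent to \<open>c \<cdot> 1\<close>.
\<close>

record ('k, 'a) graded_algebra = "'a ring" +
  scalar :: "'k \<Rightarrow> 'a"
  piece :: "nat \<Rightarrow> 'a set"

definition graded_algebra_iso ::
  "('k, 'a) graded_algebra \<Rightarrow> ('k, 'b) graded_algebra \<Rightarrow> ('a \<Rightarrow> 'b) set" where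
  "graded_algebra_iso A B =
     {\<phi> \<in> ring_iso A B. (\<forall>c. \<phi> (scalar A c) = scalar B c) \<and> (\<forall>n. \<phi> ` piece A n = piece B n)}"

definition with_grading ::
  "'a ring \<Rightarrow> ('k \<Rightarrow> 'a) \<Rightarrow> (nat \<Rightarrow> 'a set) \<Rightarrow> ('k, 'a) graded_algebra" where
  "with_grading R s P =
     \<lparr>carrier = carrier R, mult = mult R, one = \<one>\<^bsub>R\<^esub>, zero = \<zero>\<^bsub>R\<^esub>, add = add R,
      scalar = s, piece = P\<rparr>"

text \<open>\<open>filt_prev R F n\<close> is \<open>F (n - 1)\<close>, with the convention that \<open>F (-1)\<close> is zero.\<close>

definition filt_prev :: "'a ring \<Rightarrow> (nat \<Rightarrow> 'a set) \<Rightarrow> nat \<Rightarrow> 'a set" where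
  "filt_prev R F n = (case n of 0 \<Rightarrow> {\<zero>\<^bsub>R\<^esub>} | Suc m \<Rightarrow> F m)"

definition gr_comp :: "'a ring \<Rightarrow> (nat \<Rightarrow> 'a set) \<Rightarrow> nat \<Rightarrow> 'a set monoid" where
  "gr_comp R F n = ((add_monoid R)\<lparr>carrier := F n\<rparr>) Mod (filt_prev R F n)"

text \<open>The product of a class of degree \<open>m\<close> and a class of degree \<open>n\<close>.\<close>

definition gr_mult ::
  "'a ring \<Rightarrow> (nat \<Rightarrow> 'a set) \<Rightarrow> nat \<Rightarrow> nat \<Rightarrow> 'a set \<Rightarrow> 'a set \<Rightarrow> 'a set" where
  "gr_mult R F m n A B = (\<Union>a\<in>A. \<Union>b\<in>B. filt_prev R F (m + n) +>\<^bsub>R\<^esub> (a \<otimes>\<^bsub>R\<^esub> b))"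

definition gr_symbol :: "'a ring \<Rightarrow> (nat \<Rightarrow> 'a set) \<Rightarrow> nat \<Rightarrow> 'a \<Rightarrow> nat \<Rightarrow> 'a set" where
  "gr_symbol R F n a =
     (\<lambda>m. if m = n then filt_prev R F n +>\<^bsub>R\<^esub> a else \<one>\<^bsub>gr_comp R F m\<^esub>)"

text \<open>
  The groups \<open>gr_comp R F n\<close> are written multiplicatively in \<open>HOL-Algebra\<close>, so the \<open>finprod\<close>
  below is the sum over all \<open>i + j = n\<close>, and \<open>\<one>\<^bsub>gr_comp R F n\<^esub>\<close> is the zero class.
\<close>

definition gr :: "'a ring \<Rightarrow> ('k \<Rightarrow> 'a) \<Rightarrow> (nat \<Rightarrow> 'a set) \<Rightarrow> ('k, nat \<Rightarrow> 'a set) graded_algebra" where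
  "gr R s F =
     \<lparr>carrier = carrier (sum_group UNIV (gr_comp R F)),
      mult = (\<lambda>a b n. finprod (gr_comp R F n) (\<lambda>i. gr_mult R F i (n - i) (a i) (b (n - i))) {..n}),
      one = gr_symbol R F 0 \<one>\<^bsub>R\<^esub>,
      zero = \<one>\<^bsub>sum_group UNIV (gr_comp R F)\<^esub>,
      add = mult (sum_group UNIV (gr_comp R F)),
      scalar = (\<lambda>c. gr_symbol R F 0 (s c)),
      piece = (\<lambda>n. {a \<in> carrier (sum_group UNIV (gr_comp R F)).
                      \<forall>m. m \<noteq> n \<longrightarrow> a m = \<one>\<^bsub>gr_comp R F m\<^esub>})\<rparr>"


section \<open>Free and polynomial algebras on two generators\<close>

text \<open>
  Variables are indexed by the two-element type \<open>2\<close>: \<open>x\<close> has index 1 and \<open>y\<close> has index 2.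
  The free algebra is the monoid algebra of the free monoid (finitely supported functions with
  the convolution product of \<open>Poly_Mapping\<close>), and the polynomial algebra is the monoid algebra
  of the monoid of exponents \<open>2 \<Rightarrow>\<^sub>0 nat\<close>.
\<close>

datatype 'a free_monoid = Word (letters: "'a list")

instantiation free_monoid :: (type) monoid_add
begin

definition zero_free_monoid :: "'a free_monoid" where
  "0 = Word []"

definition plus_free_monoid :: "'a free_monoid \<Rightarrow> 'a free_monoid \<Rightarrow> 'a free_monoid" where
  "u + v = Word (letters u @ letters v)"

instance
  by standard (simp_all add: zero_free_monoid_def plus_free_monoid_def)

end

type_synonym 'k free_alg = "2 free_monoid \<Rightarrow>\<^sub>0 'k"
type_synonym 'k poly_alg = "(2 \<Rightarrow>\<^sub>0 nat) \<Rightarrow>\<^sub>0 'k"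

definition const :: "'k::zero \<Rightarrow> 'm::zero \<Rightarrow>\<^sub>0 'k" where
  "const c = Poly_Mapping.single 0 c"

definition free_var :: "2 \<Rightarrow> 'k::field free_alg" where
  "free_var i = Poly_Mapping.single (Word [i]) 1"

definition poly_var :: "2 \<Rightarrow> 'k::field poly_alg" where
  "poly_var i = Poly_Mapping.single (Poly_Mapping.single i 1) 1"

text \<open>The algebra homomorphisms sending the variable with index \<open>i\<close> to \<open>s i\<close>.\<close>

definition free_subst ::
  "(2 \<Rightarrow> 'm::monoid_add \<Rightarrow>\<^sub>0 'k::field) \<Rightarrow> 'k free_alg \<Rightarrow> 'm \<Rightarrow>\<^sub>0 'k" where
  "free_subst s f =
     (\<Sum>w\<in>Poly_Mapping.keys f. const (Poly_Mapping.lookup f w) * prod_list (map s (letters w)))"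

definition poly_subst ::
  "(2 \<Rightarrow> 'm::comm_monoid_add \<Rightarrow>\<^sub>0 'k::field) \<Rightarrow> 'k poly_alg \<Rightarrow> 'm \<Rightarrow>\<^sub>0 'k" where
  "poly_subst s f =
     (\<Sum>e\<in>Poly_Mapping.keys f. const (Poly_Mapping.lookup f e) *
        (\<Prod>i\<in>UNIV. s i ^ Poly_Mapping.lookup e i))"

text \<open>
  A matrix acts on the span of the variables in the usual way, the columns being the images of
  the basis vectors \<open>x, y\<close>.
\<close>

definition lin_subst :: "(2 \<Rightarrow> 'm::monoid_add \<Rightarrow>\<^sub>0 'k::field) \<Rightarrow> 'k^2^2 \<Rightarrow> 2 \<Rightarrow> 'm \<Rightarrow>\<^sub>0 'k" where
  "lin_subst v M j = (\<Sum>i\<in>UNIV. const (M $ i $ j) * v i)"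

definition free_act :: "'k::field^2^2 \<Rightarrow> 'k free_alg \<Rightarrow> 'k free_alg" where
  "free_act M = free_subst (lin_subst free_var M)"

definition poly_act :: "'k::field^2^2 \<Rightarrow> 'k poly_alg \<Rightarrow> 'k poly_alg" where
  "poly_act M = poly_subst (lin_subst poly_var M)"

definition abelianize :: "'k::field free_alg \<Rightarrow> 'k poly_alg" where
  "abelianize = free_subst poly_var"

definition free_deg :: "2 free_monoid \<Rightarrow> nat" where
  "free_deg w = length (letters w)"

definition poly_deg :: "(2 \<Rightarrow>\<^sub>0 nat) \<Rightarrow> nat" where
  "poly_deg e = (\<Sum>i\<in>UNIV. Poly_Mapping.lookup e i)"

definition hom_part :: "('m \<Rightarrow> nat) \<Rightarrow> nat \<Rightarrow> ('m \<Rightarrow>\<^sub>0 'k::comm_monoid_add) \<Rightarrow> 'm \<Rightarrow>\<^sub>0 'k" where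
  "hom_part d n f =
     (\<Sum>m\<in>{m \<in> Poly_Mapping.keys f. d m = n}. Poly_Mapping.single m (Poly_Mapping.lookup f m))"


section \<open>The group and smash products\<close>

text \<open>
  In characteristic \<open>p > 0\<close> the set \<open>range of_int\<close> is the prime field of \<open>'k\<close>, so this is
  \<open>SL(2,p)\<close>, realized inside \<open>SL(2,k)\<close>.
\<close>

definition SL2p :: "('k::field^2^2) monoid" where
  "SL2p = \<lparr>carrier = {M. det M = 1 \<and> (\<forall>i j. M $ i $ j \<in> range of_int)},
           mult = (**), one = mat 1\<rparr>"

definition gmat :: "'k::field^2^2" where
  "gmat = vector [vector [1, 1], vector [0, 1]]"

definition G :: "('k::field^2^2) monoid" where
  "G = subgroup_generated SL2p {gmat}"

definition group_algebra :: "('g, 'e) monoid_scheme \<Rightarrow> ('g \<Rightarrow>\<^sub>0 'k::zero) set" where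
  "group_algebra \<Gamma> = {l. Poly_Mapping.keys l \<subseteq> carrier \<Gamma>}"

text \<open>
  An element \<open>f\<close> of the smash product is the sum of \<open>lookup f u \<cdot> u\<close> over \<open>u\<close> in the group
  (coefficients on the left), and \<open>u a = (u \<cdot> a) u\<close>.
\<close>

definition smash_product ::
  "('g, 'e) monoid_scheme \<Rightarrow> ('g \<Rightarrow> 'a \<Rightarrow> 'a) \<Rightarrow> ('g \<Rightarrow>\<^sub>0 'a::ring_1) ring" where
  "smash_product \<Gamma> act =
     \<lparr>carrier = {f. Poly_Mapping.keys f \<subseteq> carrier \<Gamma>},
      mult = (\<lambda>f h. \<Sum>u\<in>Poly_Mapping.keys f. \<Sum>v\<in>Poly_Mapping.keys h.
                Poly_Mapping.single (u \<otimes>\<^bsub>\<Gamma>\<^esub> v)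
                  (Poly_Mapping.lookup f u * act u (Poly_Mapping.lookup h v))),
      one = Poly_Mapping.single \<one>\<^bsub>\<Gamma>\<^esub> 1,
      zero = 0,
      add = (+)\<rparr>"

definition smash_scalar :: "'k \<Rightarrow> ('k::field^2^2 \<Rightarrow>\<^sub>0 'm::monoid_add \<Rightarrow>\<^sub>0 'k)" where
  "smash_scalar c = Poly_Mapping.single \<one>\<^bsub>G\<^esub> (const c)"

text \<open>Group elements have degree 0.\<close>

definition smash_piece :: "('m \<Rightarrow> nat) \<Rightarrow> nat \<Rightarrow> ('k::field^2^2 \<Rightarrow>\<^sub>0 'm::monoid_add \<Rightarrow>\<^sub>0 'k) set" where
  "smash_piece d n =
     {f. Poly_Mapping.keys f \<subseteq> carrier G \<and>
         (\<forall>u. \<forall>m\<in>Poly_Mapping.keys (Poly_Mapping.lookup f u). d m = n)}"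

definition smash_upto :: "('m \<Rightarrow> nat) \<Rightarrow> nat \<Rightarrow> ('k::field^2^2 \<Rightarrow>\<^sub>0 'm::monoid_add \<Rightarrow>\<^sub>0 'k) set" where
  "smash_upto d n =
     {f. Poly_Mapping.keys f \<subseteq> carrier G \<and>
         (\<forall>u. \<forall>m\<in>Poly_Mapping.keys (Poly_Mapping.lookup f u). d m \<le> n)}"


section \<open>The algebras \<open>H\<^sub>\<lambda>\<close>\<close>

type_synonym 'k free_smash = "'k^2^2 \<Rightarrow>\<^sub>0 'k free_alg"
type_synonym 'k poly_smash = "'k^2^2 \<Rightarrow>\<^sub>0 'k poly_alg"

definition free_skew :: "'k::field free_smash ring" where
  "free_skew = smash_product G free_act"

definition poly_skew :: "('k::field, 'k poly_smash) graded_algebra" where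
  "poly_skew = with_grading (smash_product G poly_act) smash_scalar (smash_piece poly_deg)"

definition relator :: "('k::field^2^2 \<Rightarrow>\<^sub>0 'k) \<Rightarrow> 'k free_smash" where
  "relator l =
     Poly_Mapping.single \<one>\<^bsub>G\<^esub> (free_var 1 * free_var 2 - free_var 2 * free_var 1)
       - Poly_Mapping.map const l"

definition H_ideal :: "('k::field^2^2 \<Rightarrow>\<^sub>0 'k) \<Rightarrow> 'k free_smash set" where
  "H_ideal l = genideal free_skew {relator l}"

definition H :: "('k::field^2^2 \<Rightarrow>\<^sub>0 'k) \<Rightarrow> 'k free_smash set ring" where
  "H l = free_skew Quot (H_ideal l)"

definition H_class :: "('k::field^2^2 \<Rightarrow>\<^sub>0 'k) \<Rightarrow> 'k free_smash \<Rightarrow> 'k free_smash set" where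
  "H_class l f = H_ideal l +>\<^bsub>free_skew\<^esub> f"

definition H_scalar :: "('k::field^2^2 \<Rightarrow>\<^sub>0 'k) \<Rightarrow> 'k \<Rightarrow> 'k free_smash set" where
  "H_scalar l c = H_class l (smash_scalar c)"

definition H_filt :: "('k::field^2^2 \<Rightarrow>\<^sub>0 'k) \<Rightarrow> nat \<Rightarrow> 'k free_smash set set" where
  "H_filt l n = H_class l ` smash_upto free_deg n"

definition gr_H :: "('k::field^2^2 \<Rightarrow>\<^sub>0 'k) \<Rightarrow> ('k, nat \<Rightarrow> 'k free_smash set set) graded_algebra" where
  "gr_H l = gr (H l) (H_scalar l) (H_filt l)"

text \<open>The grading of \<open>H\<^sub>0\<close> exists because its defining relation is homogeneous.\<close>

definition H0 :: "('k::field, 'k free_smash set) graded_algebra" where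
  "H0 = with_grading (H 0) (H_scalar 0) (\<lambda>n. H_class 0 ` smash_piece free_deg n)"

text \<open>
  The natural map from \<open>H\<^sub>0\<close> to \<open>gr H\<^sub>\<lambda>\<close>: lift to the free smash product and send the
  component of degree \<open>n\<close> to its class in the quotient of \<open>H_filt l n\<close>.
\<close>

definition gr_map ::
  "('k::field^2^2 \<Rightarrow>\<^sub>0 'k) \<Rightarrow> 'k free_smash set \<Rightarrow> nat \<Rightarrow> 'k free_smash set set" where
  "gr_map l C =
     the_elem ((\<lambda>f n. filt_prev (H l) (H_filt l) n +>\<^bsub>H l\<^esub>
                        H_class l (Poly_Mapping.map (hom_part free_deg n) f)) ` C)"

text \<open>The natural map from \<open>H\<^sub>0\<close> to the skew group algebra of the polynomial algebra.\<close>

definition poly_map :: "'k::field free_smash set \<Rightarrow> 'k poly_smash" where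
  "poly_map C = the_elem (Poly_Mapping.map abelianize ` C)"

end

theory Submission
  imports Defs "HOL-Library.Function_Algebras"
begin

text \<open>
  Rewriting \<open>x y\<close> as \<open>y x + \<lambda>\<close> brings every element of \<open>H\<^sub>\<lambda>\<close> into a combination of normal
  words \<open>y\<^sup>j x\<^sup>i u\<close> with \<open>u \<in> G\<close>, and modulo lower degree the result is the abelianization. These
  words are linearly independent: on the vector space with this basis, right multiplication by the
  generators is given by explicit operators, which satisfy the relations of \<open>H\<^sub>\<lambda>\<close> because \<open>\<lambda>\<close>
  commutes with \<open>x\<close> and with \<open>G\<close>. Therefore an element of degree at most \<open>n\<close> is of lower
  degree in \<open>H\<^sub>\<lambda>\<close> exactly if the degree \<open>n\<close> part of its abelianization vanishes, a condition that
  does not involve \<open>\<lambda>\<close>.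
\<close>

section \<open>Finitely supported functions\<close>

text \<open>Rewriting alone does not exclude linear relations among normal words, and in gr
  H_\<lambda> such a relation would appear as an unexpected drop of degree; excluding them is the
  purpose of the right module. The order y^j x^i u and the multiplication from the right are chosen
  so that \<lambda> never has to pass a power of y, on which G acts nontrivially. Appending x only
  raises i, because u x = x u. Appending y to x^i u costs i \<lambda> x^(i-1), that is, \<lambda>
  times the derivative of x^i. Multiplication by x from the left would instead produce sums of terms
  y^a \<lambda> y^b. Every element of G is unitriangular and determined by its upper right entry, so
  G acts by translations on functions on the field, and \<lambda> commutes with G because
  translations commute. The resulting criterion is available for \<lambda> = 0 as well; comparing
  the two instances shows at once that the natural map from H_0 to gr H_\<lambda> is well defined
  and that it is injective.\<close>

lemma sum_keys_single:
  "h k 0 = 0 \<Longrightarrow>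
     (\<Sum>j\<in>Poly_Mapping.keys (Poly_Mapping.single k a). h j (Poly_Mapping.lookup (Poly_Mapping.single k a) j)) = h k a"
  by (cases "a = 0") auto

lemma poly_mapping_sum_singles:
  "f = (\<Sum>k\<in>Poly_Mapping.keys f. Poly_Mapping.single k (Poly_Mapping.lookup f k))"
  by (rule poly_mapping_eqI) (simp add: lookup_sum lookup_single when_def in_keys_iff)

lemma poly_mapping_induct_on [consumes 1, case_names zero single add]:
  fixes f :: "'m \<Rightarrow>\<^sub>0 'a::comm_monoid_add"
  assumes "Poly_Mapping.keys f \<subseteq> A" and "P 0"
    and "\<And>k a. k \<in> A \<Longrightarrow> P (Poly_Mapping.single k a)"
    and "\<And>f g. P f \<Longrightarrow> P g \<Longrightarrow> P (f + g)"
  shows "P f"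
proof -
  have "P (\<Sum>k\<in>K. Poly_Mapping.single k (Poly_Mapping.lookup f k))" if "finite K" "K \<subseteq> A" for K
    using that by (induction K rule: finite_induct) (auto intro: assms)
  from this[OF _ assms(1)] show ?thesis
    by (simp flip: poly_mapping_sum_singles)
qed

lemma poly_mapping_induct [case_names zero single add]:
  fixes f :: "'m \<Rightarrow>\<^sub>0 'a::comm_monoid_add"
  assumes "P 0" and "\<And>k a. P (Poly_Mapping.single k a)"
    and "\<And>f g. P f \<Longrightarrow> P g \<Longrightarrow> P (f + g)"
  shows "P f"
  using subset_UNIV[of "Poly_Mapping.keys f"]
  by (induction f rule: poly_mapping_induct_on) (auto intro: assms)

lemma lookup_map: "g 0 = 0 \<Longrightarrow> Poly_Mapping.lookup (Poly_Mapping.map g f) k = g (Poly_Mapping.lookup f k)"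
  by transfer (auto simp: when_def)

lemma map_zero [simp]: "Poly_Mapping.map g 0 = 0"
  by (simp add: map_eq_zero_iff)

lemma map_plus:
  fixes g :: "'a::ab_group_add \<Rightarrow> 'b::ab_group_add"
  assumes "\<And>a b. g (a + b) = g a + g b"
  shows "Poly_Mapping.map g (f + h) = Poly_Mapping.map g f + Poly_Mapping.map g h"
proof -
  have "g 0 = 0" using assms[of 0 0] by simp
  then show ?thesis
    by (intro poly_mapping_eqI) (simp add: lookup_map lookup_add assms)
qed

lemma keys_map_subset: "Poly_Mapping.keys (Poly_Mapping.map g f) \<subseteq> Poly_Mapping.keys f"
  by transfer (auto simp: when_def)

lemma const_0 [simp]: "const 0 = 0"
  by (simp add: const_def)

lemma const_eq_0_iff: "const a = 0 \<longleftrightarrow> a = 0"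
  unfolding const_def by (metis lookup_single_eq lookup_zero single_zero)

lemma const_add: "const (a + b) = const a + (const b :: 'm::zero \<Rightarrow>\<^sub>0 'k::comm_monoid_add)"
  by (simp add: const_def single_add)

lemma const_mult: "const (a * b) = const a * (const b :: 'm::monoid_add \<Rightarrow>\<^sub>0 'k::semiring_0)"
  by (simp add: const_def mult_single)

lemma const_1 [simp]: "const 1 = (1 :: 'm::monoid_add \<Rightarrow>\<^sub>0 'k::semiring_1)"
  by (simp add: const_def)

lemma const_commute: "const a * f = f * (const a :: 'm::monoid_add \<Rightarrow>\<^sub>0 'k::comm_semiring_0)"
  by (induction f rule: poly_mapping_induct) 
    (simp_all add: const_def mult_single algebra_simps)


section \<open>Homomorphisms from the free algebra\<close>

text \<open>Words arise by prepending letters, so an identity between homomorphisms only has to be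
  checked on scalars and on one variable at a time.\<close>

lemma free_alg_induct [case_names const var add]:
  fixes f :: "'k::field free_alg"
  assumes "\<And>a. P (const a)" and "\<And>i f. P f \<Longrightarrow> P (free_var i * f)"
    and "\<And>f g. P f \<Longrightarrow> P g \<Longrightarrow> P (f + g)"
  shows "P f"
proof (induction f rule: poly_mapping_induct)
  case zero
  show ?case using assms(1)[of 0] by simp
next
  case (single w a)
  have "P (Poly_Mapping.single (Word l) a)" for l
  proof (induction l)
    case Nil
    then show ?case using assms(1)[of a] by (simp add: const_def zero_free_monoid_def)
  next
    case (Cons i l)
    then show ?case
      using assms(2)[of "Poly_Mapping.single (Word l) a" i]
      by (simp add: free_var_def mult_single plus_free_monoid_def)
  qed
  from this[of "letters w"] show ?case by simp
qed (rule assms)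

text \<open>\<open>free_subst\<close> takes values in monoid algebras only. An arbitrary target ring
  is allowed here so that the free algebra can also be mapped to a ring of operators.\<close>

definition free_lift :: "('k::field \<Rightarrow> 'r::ring_1) \<Rightarrow> (2 \<Rightarrow> 'r) \<Rightarrow> 'k free_alg \<Rightarrow> 'r" where
  "free_lift c s f =
     (\<Sum>w\<in>Poly_Mapping.keys f. c (Poly_Mapping.lookup f w) * prod_list (map s (letters w)))"

lemma free_subst_eq_free_lift: "free_subst s = free_lift const s"
  by (rule ext) (simp add: free_subst_def free_lift_def)

locale free_alg_hom =
  fixes c :: "'k::field \<Rightarrow> 'r::ring_1" and s :: "2 \<Rightarrow> 'r"
  assumes scalar_add: "c (a + b) = c a + c b"
    and scalar_mult: "c (a * b) = c a * c b"
    and scalar_1 [simp]: "c 1 = 1"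
    and scalar_commute: "c a * s i = s i * c a"
begin

lemma scalar_0 [simp]: "c 0 = 0"
  using scalar_add[of 0 0] by simp

lemma lift_add: "free_lift c s (f + g) = free_lift c s f + free_lift c s g"
  unfolding free_lift_def
  by (rule setsum_keys_plus_distrib) (simp_all add: scalar_add algebra_simps)

lemma lift_0 [simp]: "free_lift c s 0 = 0"
  by (simp add: free_lift_def)

lemma lift_diff: "free_lift c s (f - g) = free_lift c s f - free_lift c s g"
  using lift_add[of "f - g" g] by (simp add: algebra_simps)

lemma lift_single: "free_lift c s (Poly_Mapping.single w a) = c a * prod_list (map s (letters w))"
  unfolding free_lift_def by (rule sum_keys_single) simp

lemma lift_const [simp]: "free_lift c s (const a) = c a"
  by (simp add: const_def lift_single zero_free_monoid_def)

lemma lift_1 [simp]: "free_lift c s 1 = 1"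
  using lift_const[of 1] by simp

lemma lift_var [simp]: "free_lift c s (free_var i) = s i"
  by (simp add: free_var_def lift_single)

lemma lift_var_mult: "free_lift c s (free_var i * f) = s i * free_lift c s f"
proof (induction f rule: poly_mapping_induct)
  case (single w a)
  then show ?case
    by (simp add: free_var_def mult_single lift_single plus_free_monoid_def)
       (metis scalar_commute mult.assoc)
qed (simp_all add: lift_add algebra_simps)

lemma lift_const_mult: "free_lift c s (const a * f) = c a * free_lift c s f"
proof (induction f rule: poly_mapping_induct)
  case (single w b)
  then show ?case
    by (simp add: const_def mult_single lift_single scalar_mult mult.assoc)
qed (simp_all add: lift_add distrib_left)

lemma lift_mult: "free_lift c s (f * g) = free_lift c s f * free_lift c s g"
proof (induction f rule: free_alg_induct)
  case (const a)
  then show ?case by (simp add: lift_const_mult)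
next
  case (var i f)
  then show ?case by (simp add: lift_var_mult mult.assoc)
next
  case (add f h)
  then show ?case by (simp add: lift_add distrib_right)
qed

lemma lift_power: "free_lift c s (f ^ n) = free_lift c s f ^ n"
  by (induction n) (simp_all add: lift_mult)

end

lemma free_alg_hom_const:
  "free_alg_hom (const :: 'k::field \<Rightarrow> 'm::monoid_add \<Rightarrow>\<^sub>0 'k) s"
  by standard (simp_all only: const_add const_mult const_1, rule const_commute)

interpretation free_act: free_alg_hom const "lin_subst free_var M"
  rewrites "free_lift const (lin_subst free_var M) = free_act M" for M :: "'k::field^2^2"
  by (rule free_alg_hom_const) (simp only: free_act_def free_subst_eq_free_lift)

interpretation abelianize: free_alg_hom const "poly_var :: 2 \<Rightarrow> 'k::field poly_alg"
  rewrites "free_lift const poly_var = (abelianize :: 'k free_alg \<Rightarrow> _)"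
  by (rule free_alg_hom_const) (simp only: abelianize_def free_subst_eq_free_lift)

text \<open>The columns of a matrix are the images of the variables, hence successive substitutions
  multiply the matrices in the same order; this makes \<open>free_act\<close> a left action.\<close>

lemma free_act_lin_subst: "free_act M (lin_subst free_var N j) = lin_subst free_var (M ** N) j"
proof -
  have "const a * (const b * f) = const (b * a) * f" for a b and f :: "'a free_alg"
    by (simp add: mult.commute[of b a] const_mult mult.assoc)
  then show ?thesis
    by (simp add: lin_subst_def sum_2 matrix_matrix_mult_def free_act.lift_add free_act.lift_mult
        const_add distrib_left distrib_right add.assoc add.left_commute)
qed

lemma free_act_mult: "free_act (M ** N) f = free_act M (free_act N f)"
  by (induction f rule: free_alg_induct)
     (simp_all add: free_act.lift_add free_act.lift_mult free_act_lin_subst)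

lemma lin_subst_mat_1: "lin_subst v (mat 1) j = v j"
  using exhaust_2[of j] by (auto simp: lin_subst_def sum_2 mat_def)

lemma free_act_mat_1: "free_act (mat 1) f = f"
  by (induction f rule: free_alg_induct)
     (simp_all add: free_act.lift_add free_act.lift_mult lin_subst_mat_1)

section \<open>Substitution in the polynomial algebra\<close>

lemma poly_subst_add: "poly_subst s (f + g) = poly_subst s f + poly_subst s g"
  unfolding poly_subst_def
  by (rule setsum_keys_plus_distrib) (simp_all add: const_add algebra_simps)

lemma poly_subst_single:
  "poly_subst s (Poly_Mapping.single e a) = const a * (\<Prod>i\<in>UNIV. s i ^ Poly_Mapping.lookup e i)"
  unfolding poly_subst_def by (rule sum_keys_single) simp

lemma poly_subst_const [simp]: "poly_subst s (const a) = const a"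
  by (simp add: const_def[of a] poly_subst_single)

lemma poly_subst_var_mult: "poly_subst s (poly_var i * f) = s i * poly_subst s f"
proof (induction f rule: poly_mapping_induct)
  case zero
  show ?case by (simp add: poly_subst_def)
next
  case (single e a)
  have "i = 1 \<or> i = 2" by (rule exhaust_2)
  then show ?case
    by (elim disjE)
       (simp_all add: poly_var_def mult_single poly_subst_single UNIV_2 lookup_add lookup_single
         mult.assoc mult.left_commute)
qed (simp add: poly_subst_add algebra_simps)

text \<open>This equivariance is what makes the coefficientwise abelianization multiplicative on
  smash products. The induction runs over the free algebra, so on the polynomial side it asks only
  about sums, constants and multiplication by one variable.\<close>

lemma abelianize_free_act: "abelianize (free_act M f) = poly_act M (abelianize f)"
proof (induction f rule: free_alg_induct)
  case (const a)
  show ?case by (simp add: poly_act_def)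
next
  case (var i f)
  have "abelianize (lin_subst free_var M i) = lin_subst poly_var M i"
    by (simp add: lin_subst_def sum_2 abelianize.lift_add abelianize.lift_mult)
  then show ?case
    using var by (simp add: abelianize.lift_mult free_act.lift_mult poly_act_def poly_subst_var_mult)
qed (simp add: abelianize.lift_add free_act.lift_add poly_act_def poly_subst_add)


section \<open>The group \<open>G\<close>\<close>

lemma group_SL2p: "group (SL2p :: ('k::field^2^2) monoid)"
proof (rule groupI)
  have ints: "x + y \<in> range of_int" "x * y \<in> range of_int" "- x \<in> range of_int"
    if "x \<in> range of_int" "y \<in> range of_int" for x y :: 'k
    using that by (auto simp flip: of_int_add of_int_mult of_int_minus)
  show "x \<otimes>\<^bsub>SL2p\<^esub> y \<in> carrier SL2p" if "x \<in> carrier SL2p" "y \<in> carrier SL2p" for x y :: "'k^2^2"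
  proof -
    have "(x ** y) $ i $ j \<in> range of_int" for i j
      using that by (auto simp: SL2p_def matrix_matrix_mult_def sum_2 intro!: ints)
    then show ?thesis using that by (simp add: SL2p_def det_mul)
  qed
  have "(0::'k) \<in> range of_int" "(1::'k) \<in> range of_int"
    by (auto intro: range_eqI[of _ _ 0] range_eqI[of _ _ 1])
  then show "\<one>\<^bsub>SL2p\<^esub> \<in> carrier (SL2p :: ('k^2^2) monoid)"
    using det_I[where 'a = 'k and 'n = 2] by (auto simp: SL2p_def) (auto simp: mat_def)
  show "\<exists>y\<in>carrier SL2p. y \<otimes>\<^bsub>SL2p\<^esub> x = \<one>\<^bsub>SL2p\<^esub>" if x: "x \<in> carrier SL2p" for x :: "'k^2^2"
  proof
    \<comment> \<open>The adjugate matrix, which is the inverse because the determinant is 1; its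
      entries visibly stay in the prime field.\<close>
    let ?y = "vector [vector [x$2$2, - x$1$2], vector [- x$2$1, x$1$1]] :: 'k^2^2"
    show "?y \<in> carrier SL2p"
      using x by (auto simp: SL2p_def det_2 forall_2 algebra_simps intro!: ints)
    show "?y \<otimes>\<^bsub>SL2p\<^esub> x = \<one>\<^bsub>SL2p\<^esub>"
      using x by (auto simp: SL2p_def vec_eq_iff forall_2 det_2 matrix_matrix_mult_def mat_def sum_2 algebra_simps)
  qed
qed (auto simp: SL2p_def matrix_mul_assoc)

lemma group_G: "group (G :: ('k::field^2^2) monoid)"
  unfolding G_def by (rule group.group_subgroup_generated[OF group_SL2p])

lemma mult_G [simp]: "u \<otimes>\<^bsub>G\<^esub> v = u ** v"
  by (simp add: G_def SL2p_def)

lemma one_G [simp]: "\<one>\<^bsub>G\<^esub> = mat 1"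
  by (simp add: G_def SL2p_def)

lemma mat_1_in_G [simp]: "mat 1 \<in> carrier G"
  using group.is_monoid[OF group_G] monoid.one_closed by fastforce

lemma G_closed [simp]: "u \<in> carrier G \<Longrightarrow> v \<in> carrier G \<Longrightarrow> u ** v \<in> carrier G"
  using monoid.m_closed[OF group.is_monoid[OF group_G], of u v] by simp

lemma G_unitriangular:
  fixes u :: "'k::field^2^2"
  assumes "u \<in> carrier G"
  shows "u $ 1 $ 1 = 1" "u $ 2 $ 1 = 0" "u $ 2 $ 2 = 1"
proof -
  have "u \<in> generate SL2p (carrier SL2p \<inter> {gmat})"
    using assms by (simp add: G_def carrier_subgroup_generated)
  then have "u $ 1 $ 1 = 1 \<and> u $ 2 $ 1 = 0 \<and> u $ 2 $ 2 = 1"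
  proof (induction rule: generate.induct)
    case one
    then show ?case by (simp add: SL2p_def mat_def)
  next
    case (incl h)
    then show ?case by (simp add: gmat_def)
  next
    case (inv h)
    \<comment> \<open>The inverse of the generator is not computed; its entries are read off from
      those of the product \<open>h' ** h = mat 1\<close>.\<close>
    define h' where "h' = inv\<^bsub>SL2p\<^esub> h"
    have "h' ** h = mat 1"
    proof -
      have "inv\<^bsub>SL2p\<^esub> h \<otimes>\<^bsub>SL2p\<^esub> h = \<one>\<^bsub>SL2p\<^esub>"
        using inv by (intro group.l_inv[OF group_SL2p]) blast
      then show ?thesis unfolding h'_def by (simp add: SL2p_def)
    qed
    then have "(h' ** h) $ i $ j = (if i = j then 1 else 0)" for i j
      by (simp add: mat_def)
    from this[of 1 1] this[of 2 1] this[of 2 2]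
    have "h' $ 1 $ 1 = 1" "h' $ 2 $ 1 = 0" "h' $ 2 $ 2 = 1"
      using inv by (simp_all add: matrix_matrix_mult_def sum_2 gmat_def)
    then show ?case by (simp add: h'_def)
  next
    case (eng h1 h2)
    then show ?case by (simp add: SL2p_def matrix_matrix_mult_def sum_2)
  qed
  then show "u $ 1 $ 1 = 1" "u $ 2 $ 1 = 0" "u $ 2 $ 2 = 1" by simp_all
qed

text \<open>On G this entry is an injective homomorphism to the additive group of the field, so
  group elements can be replaced by scalars.\<close>

abbreviation corner :: "'a^2^2 \<Rightarrow> 'a" where
  "corner u \<equiv> u $ 1 $ 2"

lemma G_corner_mult:
  fixes u :: "'k::field^2^2"
  assumes "u \<in> carrier G" "v \<in> carrier G"
  shows "corner (u ** v) = corner u + corner v"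
  using G_unitriangular[OF assms(1)] G_unitriangular[OF assms(2)]
  by (simp add: matrix_matrix_mult_def sum_2)

lemma G_eq_iff:
  fixes u :: "'k::field^2^2"
  assumes "u \<in> carrier G" "v \<in> carrier G"
  shows "u = v \<longleftrightarrow> corner u = corner v"
  using G_unitriangular[OF assms(1)] G_unitriangular[OF assms(2)]
  by (auto simp: vec_eq_iff forall_2)


section \<open>Smash products\<close>

lemma smash_product_simps [simp]:
  "carrier (smash_product \<Gamma> act) = {f. Poly_Mapping.keys f \<subseteq> carrier \<Gamma>}"
  "\<one>\<^bsub>smash_product \<Gamma> act\<^esub> = Poly_Mapping.single \<one>\<^bsub>\<Gamma>\<^esub> 1"
  "\<zero>\<^bsub>smash_product \<Gamma> act\<^esub> = 0"
  "add (smash_product \<Gamma> act) = (+)"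
  by (simp_all add: smash_product_def)

text \<open>Biadditivity of the smash product rests on additivity of the action alone. The
  polynomial action is treated at this level, the free action also in
  \<open>skew_action\<close>.\<close>

locale additive_action =
  fixes \<Gamma> :: "('g, 'e) monoid_scheme" and act :: "'g \<Rightarrow> 'a::ring_1 \<Rightarrow> 'a"
  assumes act_add: "act u (a + b) = act u a + act u b"
begin

abbreviation smult :: "('g \<Rightarrow>\<^sub>0 'a) \<Rightarrow> ('g \<Rightarrow>\<^sub>0 'a) \<Rightarrow> ('g \<Rightarrow>\<^sub>0 'a)" where
  "smult \<equiv> mult (smash_product \<Gamma> act)"

lemma act_0 [simp]: "act u 0 = 0"
  using act_add[of u 0 0] by simp

lemma smult_add_left: "smult (f + g) h = smult f h + smult g h"
  unfolding smash_product_def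
  by (simp, rule setsum_keys_plus_distrib)
     (simp_all add: distrib_right single_add sum.distrib)

lemma smult_add_right: "smult f (g + h) = smult f g + smult f h"
  unfolding smash_product_def
  by (simp flip: sum.distrib, rule sum.cong[OF refl], rule setsum_keys_plus_distrib)
     (simp_all add: act_add distrib_left single_add)

lemma smult_single:
  "smult (Poly_Mapping.single u a) (Poly_Mapping.single v b) =
     Poly_Mapping.single (u \<otimes>\<^bsub>\<Gamma>\<^esub> v) (a * act u b)"
  unfolding smash_product_def by (cases "a = 0"; cases "b = 0") simp_all

lemma smult_0 [simp]: "smult 0 f = 0" "smult f 0 = 0"
  by (simp_all add: smash_product_def)

end

locale skew_action = monoid \<Gamma> + additive_action \<Gamma> act
  for \<Gamma> :: "('g, 'e) monoid_scheme" and act :: "'g \<Rightarrow> 'a::ring_1 \<Rightarrow> 'a" +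
  assumes act_mult: "act u (a * b) = act u a * act u b"
    and act_1: "act u 1 = 1"
    and act_comp: "u \<in> carrier \<Gamma> \<Longrightarrow> v \<in> carrier \<Gamma> \<Longrightarrow> act (u \<otimes>\<^bsub>\<Gamma>\<^esub> v) a = act u (act v a)"
    and act_one: "act \<one>\<^bsub>\<Gamma>\<^esub> a = a"
begin

lemma smult_closed:
  assumes "Poly_Mapping.keys f \<subseteq> carrier \<Gamma>" "Poly_Mapping.keys g \<subseteq> carrier \<Gamma>"
  shows "Poly_Mapping.keys (smult f g) \<subseteq> carrier \<Gamma>"
  using assms(1)
proof (induction f rule: poly_mapping_induct_on)
  case (single u a)
  show ?case using assms(2)
  proof (induction g rule: poly_mapping_induct_on)
    case (single v b)
    then show ?case using \<open>u \<in> carrier \<Gamma>\<close> by (simp add: smult_single)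
  next
    case (add f g)
    then show ?case
      by (metis (no_types, lifting) Poly_Mapping.keys_add Un_least order_trans smult_add_right)
  qed simp
next
  case (add f h)
  then show ?case
    by (metis (no_types, lifting) Poly_Mapping.keys_add Un_least order_trans smult_add_left)
qed simp

lemma smult_assoc:
  assumes "Poly_Mapping.keys f \<subseteq> carrier \<Gamma>" "Poly_Mapping.keys g \<subseteq> carrier \<Gamma>"
    "Poly_Mapping.keys h \<subseteq> carrier \<Gamma>"
  shows "smult (smult f g) h = smult f (smult g h)"
  using assms(1)
proof (induction f rule: poly_mapping_induct_on)
  case (single u a)
  show ?case using assms(2)
  proof (induction g rule: poly_mapping_induct_on)
    case (single v b)
    show ?case using assms(3)
    proof (induction h rule: poly_mapping_induct_on)
      case (single w c)
      then show ?case using \<open>u \<in> carrier \<Gamma>\<close> \<open>v \<in> carrier \<Gamma>\<close>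
        by (simp add: smult_single m_assoc act_mult act_comp mult.assoc)
    qed (simp_all add: smult_add_right)
  qed (simp_all add: smult_add_right smult_add_left)
qed (simp_all add: smult_add_left)

lemma smult_one_left: 
  assumes "Poly_Mapping.keys f \<subseteq> carrier \<Gamma>"
  shows "smult (Poly_Mapping.single \<one>\<^bsub>\<Gamma>\<^esub> 1) f = f"
  using assms by (induction f rule: poly_mapping_induct_on)
    (simp_all add: smult_single act_one smult_add_right)

lemma smult_one_right: 
  assumes "Poly_Mapping.keys f \<subseteq> carrier \<Gamma>"
  shows "smult f (Poly_Mapping.single \<one>\<^bsub>\<Gamma>\<^esub> 1) = f"
  using assms by (induction f rule: poly_mapping_induct_on)
    (simp_all add: smult_single act_1 smult_add_left)

lemma ring_smash_product: "ring (smash_product \<Gamma> act)"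
proof (rule ringI)
  show "abelian_group (smash_product \<Gamma> act)"
  proof (rule abelian_groupI)
    show "\<exists>y\<in>carrier (smash_product \<Gamma> act). y \<oplus>\<^bsub>smash_product \<Gamma> act\<^esub> x = \<zero>\<^bsub>smash_product \<Gamma> act\<^esub>"
      if "x \<in> carrier (smash_product \<Gamma> act)" for x
      using that by (intro bexI[of _ "- x"]) (auto simp: in_keys_iff subset_eq)
    show "x \<oplus>\<^bsub>smash_product \<Gamma> act\<^esub> y \<in> carrier (smash_product \<Gamma> act)"
      if "x \<in> carrier (smash_product \<Gamma> act)" "y \<in> carrier (smash_product \<Gamma> act)" for x y
      using that Poly_Mapping.keys_add[of x y] by auto
  qed (simp_all add: add_ac)
  show "Group.monoid (smash_product \<Gamma> act)"
    by (rule monoidI)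
       (use smult_closed smult_assoc smult_one_left smult_one_right in auto)
qed (simp_all add: smult_add_left smult_add_right)

end

lemma ring_smash_minus:
  assumes "ring (smash_product \<Gamma> act)" "Poly_Mapping.keys f \<subseteq> carrier \<Gamma>"
  shows "\<ominus>\<^bsub>smash_product \<Gamma> act\<^esub> f = - f"
proof -
  interpret ring "smash_product \<Gamma> act" by fact
  show ?thesis
    by (rule minus_equality) (use assms(2) in \<open>auto simp: in_keys_iff subset_eq\<close>)
qed

interpretation free_skew: skew_action "G :: ('k::field^2^2) monoid" free_act
  rewrites "smash_product G free_act = (free_skew :: 'k free_smash ring)"
proof -
  interpret G: group "G :: ('k^2^2) monoid" by (rule group_G)
  show "skew_action (G :: ('k^2^2) monoid) free_act"
    by standard
       (simp_all add: free_act.lift_add free_act.lift_mult free_act_mult free_act_mat_1)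
qed (simp add: free_skew_def)


lemma free_skew_simps [simp]:
  "carrier free_skew = {f. Poly_Mapping.keys f \<subseteq> carrier G}"
  "\<one>\<^bsub>free_skew\<^esub> = Poly_Mapping.single (mat 1) 1"
  "\<zero>\<^bsub>free_skew\<^esub> = 0"
  "add free_skew = (+)"
  by (simp_all add: free_skew_def)

lemma ring_free_skew: "ring (free_skew :: 'k::field free_smash ring)"
  by (rule free_skew.ring_smash_product)

lemma free_skew_minus:
  "Poly_Mapping.keys f \<subseteq> carrier G \<Longrightarrow> \<ominus>\<^bsub>free_skew\<^esub> f = - f"
  unfolding free_skew_def
  by (rule ring_smash_minus[OF ring_free_skew[unfolded free_skew_def]])


lemma relator_closed:
  assumes "l \<in> group_algebra G"
  shows "Poly_Mapping.keys (relator l) \<subseteq> carrier G"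
  unfolding relator_def
  using assms keys_map_subset[of const l] keys_diff
  by (fastforce simp: group_algebra_def split: if_splits)

lemma ideal_H_ideal:
  assumes "l \<in> group_algebra G"
  shows "ideal (H_ideal l) free_skew"
  unfolding H_ideal_def using relator_closed[OF assms]
  by (intro ring.genideal_ideal[OF ring_free_skew]) simp

text \<open>The kernel of such a map is an ideal containing the relator. Only the vanishing of
  products is asked for, so the target needs no multiplication: this fits both the operators on the
  module and the abelianization, whose product belongs to a ring record.\<close>

lemma H_ideal_kernel:
  fixes \<phi> :: "'k::field free_smash \<Rightarrow> 'b::ab_group_add"
  assumes l: "l \<in> group_algebra G" and "f \<in> H_ideal l"
    and add: "\<And>f g. \<phi> (f + g) = \<phi> f + \<phi> g"
    and mult: "\<And>f g. Poly_Mapping.keys f \<subseteq> carrier G \<Longrightarrow> Poly_Mapping.keys g \<subseteq> carrier G \<Longrightarrow>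
      \<phi> f = 0 \<or> \<phi> g = 0 \<Longrightarrow> \<phi> (f \<otimes>\<^bsub>free_skew\<^esub> g) = 0"
    and rel: "\<phi> (relator l) = 0"
  shows "\<phi> f = 0"
proof -
  let ?K = "{f. Poly_Mapping.keys f \<subseteq> carrier G \<and> \<phi> f = 0}"
  interpret ring "free_skew :: 'k free_smash ring" by (rule ring_free_skew)
  have zero: "\<phi> 0 = 0"
    using add[of 0 0] by simp
  have minus: "\<phi> (- f) = - \<phi> f" for f
    using add[of f "- f"] zero by (simp add: eq_neg_iff_add_eq_0 add.commute)
  have "ideal ?K free_skew"
  proof (rule idealI[OF ring_free_skew])
    show "subgroup ?K (add_monoid free_skew)"
    proof (rule add.subgroupI)
      show "\<ominus>\<^bsub>free_skew\<^esub> f \<in> ?K" if "f \<in> ?K" for f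
        using that a_inv_closed[of f] by (simp add: free_skew_minus minus)
      show "f \<oplus>\<^bsub>free_skew\<^esub> g \<in> ?K" if "f \<in> ?K" "g \<in> ?K" for f g
        using that a_closed[of f g] by (simp add: add)
    qed (auto intro!: exI[of _ 0] simp: zero)
  next
    fix f g
    assume "f \<in> ?K" "g \<in> carrier (free_skew :: 'k free_smash ring)"
    then show "g \<otimes>\<^bsub>free_skew\<^esub> f \<in> ?K" "f \<otimes>\<^bsub>free_skew\<^esub> g \<in> ?K"
      using m_closed[of f g] m_closed[of g f] by (simp_all add: mult)
  qed
  moreover have "{relator l} \<subseteq> ?K"
    using relator_closed[OF l] by (simp add: rel)
  ultimately have "H_ideal l \<subseteq> ?K"
    unfolding H_ideal_def by (rule genideal_minimal)
  then show ?thesis using assms(2) by auto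
qed


section \<open>Degrees\<close>

text \<open>A set of admissible degrees lets \<open>{n}\<close>, \<open>{..n}\<close>,
  \<open>{..<n}\<close> and \<open>UNIV\<close> share one family of closure rules.\<close>

definition deg_in :: "('m \<Rightarrow> nat) \<Rightarrow> nat set \<Rightarrow> ('m \<Rightarrow>\<^sub>0 'a::zero) set" where
  "deg_in d S = {a. \<forall>m\<in>Poly_Mapping.keys a. d m \<in> S}"

lemma deg_in_0 [simp]: "0 \<in> deg_in d S"
  by (simp add: deg_in_def)

lemma deg_in_add: "a \<in> deg_in d S \<Longrightarrow> b \<in> deg_in d S \<Longrightarrow> a + b \<in> deg_in d S"
  unfolding deg_in_def using Poly_Mapping.keys_add by fastforce

lemma deg_in_diff:
  fixes a b :: "'m \<Rightarrow>\<^sub>0 'a::ab_group_add"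
  shows "a \<in> deg_in d S \<Longrightarrow> b \<in> deg_in d S \<Longrightarrow> a - b \<in> deg_in d S"
  unfolding deg_in_def by (auto simp: in_keys_iff lookup_minus)

lemma deg_in_mono: "a \<in> deg_in d S \<Longrightarrow> S \<subseteq> T \<Longrightarrow> a \<in> deg_in d T"
  by (auto simp: deg_in_def)

lemma deg_in_single: "d m \<in> S \<Longrightarrow> Poly_Mapping.single m a \<in> deg_in d S"
  by (simp add: deg_in_def)

lemma deg_in_mult:
  fixes a b :: "'m::monoid_add \<Rightarrow>\<^sub>0 'a::semiring_0"
  assumes "a \<in> deg_in d S" "b \<in> deg_in d T"
    and "\<And>m n. d (m + n) = d m + d n" "\<And>s t. s \<in> S \<Longrightarrow> t \<in> T \<Longrightarrow> s + t \<in> U"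
  shows "a * b \<in> deg_in d U"
  using assms(1,2) subsetD[OF Poly_Mapping.keys_mult[of a b]]
  by (auto simp: deg_in_def assms(3) intro!: assms(4) dest!: subsetD[OF Poly_Mapping.keys_mult])

lemma deg_in_const: "d 0 = 0 \<Longrightarrow> const a \<in> deg_in d {0}"
  by (simp add: const_def deg_in_single)

lemma free_deg_simps [simp]: "free_deg 0 = 0" "free_deg (Word l) = length l" "free_deg (v + w) = free_deg v + free_deg w"
  by (simp_all add: free_deg_def zero_free_monoid_def plus_free_monoid_def)

lemma poly_deg_simps [simp]: "poly_deg 0 = 0" "poly_deg (e + e') = poly_deg e + poly_deg e'"
  by (simp_all add: poly_deg_def sum_2 lookup_add)

text \<open>A word goes to a product of as many degree 1 elements as it has letters. This serves
  both the matrix action and the abelianization.\<close>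

lemma free_lift_deg_in:
  fixes s :: "2 \<Rightarrow> 'm::monoid_add \<Rightarrow>\<^sub>0 'k::field"
  assumes s: "\<And>i. s i \<in> deg_in d {1}" and d: "d 0 = 0" "\<And>m n. d (m + n) = d m + d n"
    and "f \<in> deg_in free_deg S"
  shows "free_lift const s f \<in> deg_in d S"
proof -
  interpret free_alg_hom const s by (rule free_alg_hom_const)
  have prod: "prod_list (map s l) \<in> deg_in d {length l}" for l
  proof (induction l)
    case Nil
    then show ?case using deg_in_const[of d "1::'k"] d by simp
  next
    case (Cons i l)
    show ?case
      using deg_in_mult[OF s[of i] Cons d(2)] by simp
  qed
  have "Poly_Mapping.keys f \<subseteq> {w. free_deg w \<in> S}"
    using assms(4) by (auto simp: deg_in_def)
  then show ?thesis
  proof (induction f rule: poly_mapping_induct_on)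
    case (single w a)
    then show ?case
      using deg_in_mult[OF deg_in_const[of d a] prod[of "letters w"] d(2), of S] d
      by (simp add: lift_single free_deg_def)
  qed (simp_all add: lift_add deg_in_add)
qed

lemma free_var_deg_in: "free_var i \<in> deg_in free_deg {1}"
  by (simp add: free_var_def deg_in_single)

lemma poly_var_deg_in: "poly_var i \<in> deg_in poly_deg {1}"
  using exhaust_2[of i] by (auto simp: poly_var_def poly_deg_def sum_2 lookup_single intro!: deg_in_single)

lemma lin_subst_deg_in: "lin_subst free_var M i \<in> deg_in free_deg {1}"
proof -
  have "const a * free_var j \<in> deg_in free_deg {1}" for a :: 'a and j
    by (rule deg_in_mult[OF deg_in_const free_var_deg_in]) simp_all
  then show ?thesis by (simp add: lin_subst_def sum_2 deg_in_add)
qed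

lemma free_act_deg_in: "f \<in> deg_in free_deg S \<Longrightarrow> free_act M f \<in> deg_in free_deg S"
  unfolding free_act_def free_subst_eq_free_lift
  by (rule free_lift_deg_in[OF lin_subst_deg_in]) simp_all

lemma abelianize_deg_in: "f \<in> deg_in free_deg S \<Longrightarrow> abelianize f \<in> deg_in poly_deg S"
  unfolding abelianize_def free_subst_eq_free_lift
  by (rule free_lift_deg_in[OF poly_var_deg_in]) simp_all

lemma lookup_hom_part:
  "Poly_Mapping.lookup (hom_part d n f) m = (if d m = n then Poly_Mapping.lookup f m else 0)"
proof -
  have "Poly_Mapping.lookup (hom_part d n f) m =
      (\<Sum>k\<in>{k \<in> Poly_Mapping.keys f. d k = n}. if k = m then Poly_Mapping.lookup f k else 0)"
    by (simp add: hom_part_def lookup_sum lookup_single when_def)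
  also have "\<dots> = (if d m = n then Poly_Mapping.lookup f m else 0)"
    by (simp add: in_keys_iff)
  finally show ?thesis .
qed

lemma hom_part_0 [simp]: "hom_part d n 0 = 0"
  by (simp add: hom_part_def)

lemma hom_part_add: "hom_part d n (f + g) = hom_part d n f + hom_part d n g"
  by (rule poly_mapping_eqI) (simp add: lookup_hom_part lookup_add)

lemma hom_part_single:
  "hom_part d n (Poly_Mapping.single m a) = (if d m = n then Poly_Mapping.single m a else 0)"
  by (rule poly_mapping_eqI) (simp add: lookup_hom_part lookup_single when_def)

lemma hom_part_deg_in: "f \<in> deg_in d {k} \<Longrightarrow> hom_part d n f = (if k = n then f else 0)"
  by (rule poly_mapping_eqI) (auto simp: lookup_hom_part deg_in_def in_keys_iff)

lemma abelianize_hom_part: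
  "abelianize (hom_part free_deg n f) = hom_part poly_deg n (abelianize f)"
proof (induction f rule: poly_mapping_induct)
  case (single w a)
  have "abelianize (Poly_Mapping.single w a) \<in> deg_in poly_deg {free_deg w}"
    by (rule abelianize_deg_in) (simp add: deg_in_single)
  then show ?case
    by (simp add: hom_part_single hom_part_deg_in)
qed (simp_all add: hom_part_add abelianize.lift_add)

section \<open>Degrees and homogeneous parts in smash products\<close>

definition smash_deg_in ::
    "('m \<Rightarrow> nat) \<Rightarrow> nat set \<Rightarrow> ('k::field^2^2 \<Rightarrow>\<^sub>0 'm::monoid_add \<Rightarrow>\<^sub>0 'k) set" where
  "smash_deg_in d S = {f. Poly_Mapping.keys f \<subseteq> carrier G \<and> (\<forall>u. Poly_Mapping.lookup f u \<in> deg_in d S)}"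

lemma smash_deg_in_iff:
  "f \<in> smash_deg_in d S \<longleftrightarrow> Poly_Mapping.keys f \<subseteq> carrier G \<and>
     (\<forall>u m. Poly_Mapping.lookup (Poly_Mapping.lookup f u) m \<noteq> 0 \<longrightarrow> d m \<in> S)"
  by (auto simp: smash_deg_in_def deg_in_def in_keys_iff)

lemma smash_piece_eq: "smash_piece d n = smash_deg_in d {n}"
  by (simp add: smash_piece_def smash_deg_in_def deg_in_def)

lemma smash_upto_eq: "smash_upto d n = smash_deg_in d {..n}"
  by (simp add: smash_upto_def smash_deg_in_def deg_in_def)

lemma smash_deg_in_UNIV: "smash_deg_in d UNIV = {f. Poly_Mapping.keys f \<subseteq> carrier G}"
  by (simp add: smash_deg_in_def deg_in_def)

lemma smash_deg_in_keys: "f \<in> smash_deg_in d S \<Longrightarrow> Poly_Mapping.keys f \<subseteq> carrier G"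
  by (simp add: smash_deg_in_def)

lemma smash_deg_in_empty: "smash_deg_in d {} = {0}"
  by (auto simp: smash_deg_in_def deg_in_def in_keys_iff poly_mapping_eq_iff fun_eq_iff)

lemma smash_deg_in_0 [simp]: "0 \<in> smash_deg_in d S"
  by (simp add: smash_deg_in_def)

lemma smash_deg_in_add: "f \<in> smash_deg_in d S \<Longrightarrow> g \<in> smash_deg_in d S \<Longrightarrow> f + g \<in> smash_deg_in d S"
  using Poly_Mapping.keys_add[of f g] by (auto simp: smash_deg_in_def lookup_add deg_in_add)

lemma smash_deg_in_diff: "f \<in> smash_deg_in d S \<Longrightarrow> g \<in> smash_deg_in d S \<Longrightarrow> f - g \<in> smash_deg_in d S"
  using keys_diff[of f g] by (auto simp: smash_deg_in_def lookup_minus deg_in_diff)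

lemma smash_deg_in_sum: "(\<And>i. i \<in> I \<Longrightarrow> f i \<in> smash_deg_in d S) \<Longrightarrow> sum f I \<in> smash_deg_in d S"
  by (induction I rule: infinite_finite_induct) (auto intro: smash_deg_in_add)

lemma smash_deg_in_mono: "f \<in> smash_deg_in d S \<Longrightarrow> S \<subseteq> T \<Longrightarrow> f \<in> smash_deg_in d T"
  by (auto simp: smash_deg_in_def elim: deg_in_mono)

lemma smash_deg_in_single: "u \<in> carrier G \<Longrightarrow> a \<in> deg_in d S \<Longrightarrow> Poly_Mapping.single u a \<in> smash_deg_in d S"
  by (auto simp: smash_deg_in_def lookup_single when_def)

lemma smash_deg_in_induct [consumes 1, case_names zero single add]:
  assumes "f \<in> smash_deg_in d S" "P 0"
    and "\<And>u m a. u \<in> carrier G \<Longrightarrow> d m \<in> S \<Longrightarrow> P (Poly_Mapping.single u (Poly_Mapping.single m a))"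
    and "\<And>f g. P f \<Longrightarrow> P g \<Longrightarrow> P (f + g)"
  shows "P f"
proof -
  have "P (Poly_Mapping.single u a)" if "u \<in> carrier G" "Poly_Mapping.keys a \<subseteq> {m. d m \<in> S}" for u a
    using that(2) by (induction a rule: poly_mapping_induct_on) (simp_all add: assms that single_add)
  then have *: "P (Poly_Mapping.single u (Poly_Mapping.lookup f u))" if "u \<in> carrier G" for u
    using assms(1) that by (simp add: smash_deg_in_def deg_in_def subset_eq)
  have "P (\<Sum>u\<in>K. Poly_Mapping.single u (Poly_Mapping.lookup f u))" if "finite K" "K \<subseteq> carrier G" for K
    using that by (induction K rule: finite_induct) (auto intro: assms *)
  from this[OF _ smash_deg_in_keys[OF assms(1)]] show ?thesis
    by (simp flip: poly_mapping_sum_singles)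
qed

lemma free_skew_mult_deg_in:
  assumes "f \<in> smash_deg_in free_deg S" "g \<in> smash_deg_in free_deg T"
    and U: "\<And>s t. s \<in> S \<Longrightarrow> t \<in> T \<Longrightarrow> s + t \<in> U"
  shows "f \<otimes>\<^bsub>free_skew\<^esub> g \<in> smash_deg_in free_deg U"
  using assms(1)
proof (induction f rule: smash_deg_in_induct)
  case (single u v a)
  show ?case using assms(2)
  proof (induction g rule: smash_deg_in_induct)
    case (single u' v' a')
    have "Poly_Mapping.single v a * free_act u (Poly_Mapping.single v' a') \<in> deg_in free_deg U"
      by (rule deg_in_mult[OF deg_in_single free_act_deg_in[OF deg_in_single]])
         (use single \<open>free_deg v \<in> S\<close> U in auto)
    then show ?case
      using single \<open>u \<in> carrier G\<close> by (simp add: free_skew.smult_single smash_deg_in_single)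
  qed (simp_all add: free_skew.smult_add_right smash_deg_in_add)
qed (simp_all add: free_skew.smult_add_left smash_deg_in_add)

abbreviation smash_part ::
    "('m \<Rightarrow> nat) \<Rightarrow> nat \<Rightarrow> ('k::field^2^2 \<Rightarrow>\<^sub>0 'm::monoid_add \<Rightarrow>\<^sub>0 'k) \<Rightarrow> 'k^2^2 \<Rightarrow>\<^sub>0 'm \<Rightarrow>\<^sub>0 'k" where
  "smash_part d n \<equiv> Poly_Mapping.map (hom_part d n)"

lemma lookup_smash_part:
  "Poly_Mapping.lookup (Poly_Mapping.lookup (smash_part d n f) u) m =
     (if d m = n then Poly_Mapping.lookup (Poly_Mapping.lookup f u) m else 0)"
  by (simp add: lookup_map lookup_hom_part)

lemma smash_part_0 [simp]: "smash_part d n 0 = 0"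
  by (intro poly_mapping_eqI) (simp add: lookup_smash_part)

lemma smash_part_add: "smash_part d n (f + g) = smash_part d n f + smash_part d n g"
  by (intro poly_mapping_eqI) (simp add: lookup_smash_part lookup_add)

lemma smash_part_diff: "smash_part d n (f - g) = smash_part d n f - smash_part d n g"
  by (intro poly_mapping_eqI) (simp add: lookup_smash_part lookup_minus)

text \<open>The intersection carries two facts: the part is homogeneous of degree \<open>n\<close>,
  and it vanishes if \<open>n\<close> is not in \<open>S\<close>.\<close>

lemma smash_part_deg_in:
  assumes "f \<in> smash_deg_in d S"
  shows "smash_part d n f \<in> smash_deg_in d (S \<inter> {n})"
  using assms order_trans[OF keys_map_subset smash_deg_in_keys[OF assms]]
  by (auto simp: smash_deg_in_iff lookup_smash_part)

lemma smash_part_homogeneous: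
  assumes "f \<in> smash_deg_in d {k}"
  shows "smash_part d n f = (if k = n then f else 0)"
  using assms 
  by (intro poly_mapping_eqI) (auto simp: lookup_smash_part smash_deg_in_iff)

lemma smash_part_eq_0_iff: "(\<forall>n. smash_part d n f = 0) \<longleftrightarrow> f = 0"
proof
  assume *: "\<forall>n. smash_part d n f = 0"
  have "Poly_Mapping.lookup (Poly_Mapping.lookup f u) m = 0" for u m
    using arg_cong[OF *[rule_format, of "d m"], of "\<lambda>h. Poly_Mapping.lookup (Poly_Mapping.lookup h u) m"]
    by (simp add: lookup_smash_part)
  then show "f = 0" by (intro poly_mapping_eqI) simp
qed simp

lemma smash_part_top: "f \<in> smash_deg_in d {..n} \<Longrightarrow> f - smash_part d n f \<in> smash_deg_in d {..<n}"
proof -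
  assume f: "f \<in> smash_deg_in d {..n}"
  then have "f - smash_part d n f \<in> smash_deg_in d {..n}"
    using smash_part_deg_in[OF f, of n] by (intro smash_deg_in_diff) (auto elim: smash_deg_in_mono)
  then show ?thesis
    by (force simp: smash_deg_in_iff lookup_smash_part lookup_minus order.strict_iff_order)
qed

lemma smash_deg_in_bounded:
  assumes "f \<in> smash_deg_in d UNIV"
  obtains N where "f \<in> smash_deg_in d {..N}"
proof -
  from assms have "\<exists>N. f \<in> smash_deg_in d {..N}"
  proof (induction f rule: smash_deg_in_induct)
    case (single u m a)
    then have "Poly_Mapping.single u (Poly_Mapping.single m a) \<in> smash_deg_in d {..d m}"
      by (intro smash_deg_in_single deg_in_single) auto
    then show ?case ..
  next
    case (add f g)
    then obtain M N where "f \<in> smash_deg_in d {..M}" "g \<in> smash_deg_in d {..N}" by auto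
    then have "f + g \<in> smash_deg_in d {..max M N}"
      by (intro smash_deg_in_add) (auto elim: smash_deg_in_mono)
    then show ?case ..
  qed auto
  then show ?thesis using that by blast
qed

lemma smash_part_mult:
  assumes "f \<in> smash_deg_in free_deg UNIV" "g \<in> smash_deg_in free_deg UNIV"
  shows "smash_part free_deg n (f \<otimes>\<^bsub>free_skew\<^esub> g) =
    (\<Sum>i\<le>n. smash_part free_deg i f \<otimes>\<^bsub>free_skew\<^esub> smash_part free_deg (n - i) g)"
  using assms(1)
proof (induction f rule: smash_deg_in_induct)
  case (single u v a)
  let ?f = "Poly_Mapping.single u (Poly_Mapping.single v a)"
  have f: "?f \<in> smash_deg_in free_deg {free_deg v}"
    using single by (simp add: smash_deg_in_single deg_in_single)
  show ?case using assms(2)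
  proof (induction g rule: smash_deg_in_induct)
    case (single u' v' a')
    let ?g = "Poly_Mapping.single u' (Poly_Mapping.single v' a')"
    have g: "?g \<in> smash_deg_in free_deg {free_deg v'}"
      using single by (simp add: smash_deg_in_single deg_in_single)
    have "?f \<otimes>\<^bsub>free_skew\<^esub> ?g \<in> smash_deg_in free_deg {free_deg v + free_deg v'}"
      by (rule free_skew_mult_deg_in[OF f g]) simp
    moreover have "(\<Sum>i\<le>n. smash_part free_deg i ?f \<otimes>\<^bsub>free_skew\<^esub> smash_part free_deg (n - i) ?g)
        = (\<Sum>i\<le>n. if i = free_deg v then (if free_deg v' = n - free_deg v then ?f \<otimes>\<^bsub>free_skew\<^esub> ?g else 0) else 0)"
      by (rule sum.cong) (auto simp: smash_part_homogeneous[OF f] smash_part_homogeneous[OF g])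
    \<comment> \<open>The sum collapses to the index \<open>free_deg v\<close>, provided that it is
      at most \<open>n\<close>; under that bound the truncated subtraction is a genuine
      difference.\<close>
    moreover have "free_deg v + free_deg v' = n \<longleftrightarrow> free_deg v \<le> n \<and> free_deg v' = n - free_deg v"
      by auto
    ultimately show ?case
      by (simp add: smash_part_homogeneous del: map_single)
  qed (simp_all add: free_skew.smult_add_right smash_part_add sum.distrib)
qed (simp_all add: free_skew.smult_add_left smash_part_add sum.distrib)


section \<open>Additive endomorphisms\<close>

text \<open>As a type of class \<open>ring_1\<close>, the endomorphisms can be the target of
  \<open>free_lift\<close>. The sort \<open>zero_neq_one\<close> on the underlying group ensures
  that the identity differs from 0.\<close>

typedef (overloaded) 'a endo = "{f :: 'a::{ab_group_add,zero_neq_one} \<Rightarrow> 'a. \<forall>x y. f (x + y) = f x + f y}"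
  morphisms apply_endo Endo
  by (rule exI[of _ id]) simp

setup_lifting type_definition_endo

text \<open>The product is composition in diagram order, since the endomorphisms act on the right.\<close>

instantiation endo :: ("{ab_group_add,zero_neq_one}") ring_1
begin

lift_definition zero_endo :: "'a endo" is "\<lambda>_. 0" by simp
lift_definition one_endo :: "'a endo" is "\<lambda>x. x" by simp
lift_definition plus_endo :: "'a endo \<Rightarrow> 'a endo \<Rightarrow> 'a endo" is "\<lambda>f g x. f x + g x"
  by (simp add: algebra_simps)
lift_definition minus_endo :: "'a endo \<Rightarrow> 'a endo \<Rightarrow> 'a endo" is "\<lambda>f g x. f x - g x"
  by (simp add: algebra_simps)
lift_definition uminus_endo :: "'a endo \<Rightarrow> 'a endo" is "\<lambda>f x. - f x"
  by (simp add: algebra_simps)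
lift_definition times_endo :: "'a endo \<Rightarrow> 'a endo \<Rightarrow> 'a endo" is "\<lambda>f g x. g (f x)"
  by simp

instance
proof
  show "(0::'a endo) \<noteq> 1"
    by transfer (metis zero_neq_one)
qed (transfer; simp add: fun_eq_iff algebra_simps)+

end

lemma apply_endo_simps [simp]:
  "apply_endo 0 x = 0" "apply_endo 1 x = x" "apply_endo (f + g) x = apply_endo f x + apply_endo g x"
  "apply_endo (f - g) x = apply_endo f x - apply_endo g x" "apply_endo (f * g) x = apply_endo g (apply_endo f x)"
  by (transfer; simp)+

lemma apply_endo_sum: "apply_endo (sum f I) x = (\<Sum>i\<in>I. apply_endo (f i) x)"
  by (induction I rule: infinite_finite_induct) simp_all

lemma apply_Endo: "(\<And>x y. f (x + y) = f x + f y) \<Longrightarrow> apply_endo (Endo f) = f"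
  by (simp add: Endo_inverse)

lemma endo_eqI: "(\<And>x. apply_endo f x = apply_endo g x) \<Longrightarrow> f = g"
  by transfer auto


section \<open>A right module over \<open>H\<^sub>\<lambda>\<close>\<close>

text \<open>
  The function \<open>m\<close> stands for the sum of \<open>m a\<close> times the unitriangular matrix with upper right
  entry \<open>a\<close>. Its values are polynomials in \<open>x\<close> (outer variable) and \<open>y\<close> (inner variable),
  written with \<open>y\<close> to the left of \<open>x\<close>; the operators describe right multiplication in this basis.
  The formula for \<open>y\<close> comes from \<open>x\<^sup>i y = y x\<^sup>i + i \<lambda> x\<^bsup>i-1\<^esup>\<close> (as \<open>\<lambda>\<close> commutes with \<open>x\<close>)
  and \<open>u y = (y + a x) u\<close> for \<open>u\<close> with upper right entry \<open>a\<close>.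
\<close>

type_synonym 'k pbw_module = "'k \<Rightarrow> 'k poly poly"

definition scalar_op :: "'k::field \<Rightarrow> 'k pbw_module endo" where
  "scalar_op c = Endo (\<lambda>m a. smult [:c:] (m a))"

definition shift_op :: "'k::field \<Rightarrow> 'k pbw_module endo" where
  "shift_op b = Endo (\<lambda>m a. m (a - b))"

definition x_op :: "'k::field pbw_module endo" where
  "x_op = Endo (\<lambda>m a. [:0, 1:] * m a)"

definition y_op :: "('k::field^2^2 \<Rightarrow>\<^sub>0 'k) \<Rightarrow> 'k pbw_module endo" where
  "y_op l = Endo (\<lambda>m a. [:[:0, 1:], [:a:]:] * m a +
     (\<Sum>v\<in>Poly_Mapping.keys l. smult [:Poly_Mapping.lookup l v:] (pderiv (m (a - corner v)))))"

lemma apply_scalar_op: "apply_endo (scalar_op c) m = (\<lambda>a. smult [:c:] (m a))"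
  by (simp add: scalar_op_def apply_Endo fun_eq_iff smult_add_right)

lemma apply_shift_op: "apply_endo (shift_op b) m = (\<lambda>a. m (a - b))"
  by (simp add: shift_op_def apply_Endo fun_eq_iff)

lemma apply_x_op: "apply_endo x_op m = (\<lambda>a. [:0, 1:] * m a)"
  by (simp add: x_op_def apply_Endo fun_eq_iff smult_add_right)

lemma apply_y_op: "apply_endo (y_op l) m = (\<lambda>a. [:[:0, 1:], [:a:]:] * m a +
     (\<Sum>v\<in>Poly_Mapping.keys l. smult [:Poly_Mapping.lookup l v:] (pderiv (m (a - corner v)))))"
  unfolding y_op_def
  by (subst apply_Endo)
     (simp_all add: fun_eq_iff pderiv_add smult_add_right sum.distrib distrib_left del: mult_pCons_left)

definition var_op :: "('k::field^2^2 \<Rightarrow>\<^sub>0 'k) \<Rightarrow> 2 \<Rightarrow> 'k pbw_module endo" where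
  "var_op l i = (if i = 1 then x_op else y_op l)"

lemma smult_sum_right: "smult c (sum f I) = (\<Sum>i\<in>I. smult c (f i))"
  by (induction I rule: infinite_finite_induct) (simp_all add: smult_add_right)

lemma free_alg_hom_var_op: "free_alg_hom scalar_op (var_op l)"
proof
  fix c :: 'a and i
  show "scalar_op c * var_op l i = var_op l i * scalar_op c"
    by (rule endo_eqI; cases "i = 1"; rule ext)
       (simp_all add: var_op_def apply_x_op apply_y_op apply_scalar_op smult_add_right
         pderiv_smult smult_sum_right mult.commute)
next
  fix a b :: 'a
  show "scalar_op (a + b) = scalar_op a + scalar_op b"
    by (rule endo_eqI, rule ext) (simp add: apply_scalar_op flip: smult_add_left)
  show "scalar_op (a * b) = scalar_op a * scalar_op b"
    by (rule endo_eqI, rule ext) (simp add: apply_scalar_op mult.commute)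
  show "scalar_op (1 :: 'a) = 1"
    by (rule endo_eqI, rule ext) (simp add: apply_scalar_op flip: one_pCons)
qed

interpretation var_op: free_alg_hom scalar_op "var_op l" for l :: "'k::field^2^2 \<Rightarrow>\<^sub>0 'k"
  by (rule free_alg_hom_var_op)

text \<open>Right multiplication by a u is right multiplication by a followed by that by u, which in
  diagram order is a product with the factors in the same order.\<close>

definition smash_op :: "('k::field^2^2 \<Rightarrow>\<^sub>0 'k) \<Rightarrow> 'k free_smash \<Rightarrow> 'k pbw_module endo" where
  "smash_op l f = (\<Sum>u\<in>Poly_Mapping.keys f.
     free_lift scalar_op (var_op l) (Poly_Mapping.lookup f u) * shift_op (corner u))"

lemma smash_op_add: "smash_op l (f + g) = smash_op l f + smash_op l g"
  unfolding smash_op_def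
  by (rule setsum_keys_plus_distrib) (simp_all add: var_op.lift_add distrib_right)

lemma smash_op_diff: "smash_op l (f - g) = smash_op l f - smash_op l g"
  using smash_op_add[of l "f - g" g] by (simp add: algebra_simps)

lemma smash_op_0 [simp]: "smash_op l 0 = 0"
  by (simp add: smash_op_def)

lemma smash_op_single:
  "smash_op l (Poly_Mapping.single u a) = free_lift scalar_op (var_op l) a * shift_op (corner u)"
  unfolding smash_op_def by (rule sum_keys_single) simp

text \<open>The operators thus satisfy the smash product relation between u and f. For y,
  translating by b = \<open>corner u\<close> replaces the factor y + a x by y + (a - b) x, and the
  missing b x is supplied by u acting on y; the terms from \<open>l\<close> agree because
  translations commute.\<close>

lemma shift_op_commute:
  assumes u: "u \<in> carrier G"
  shows "shift_op (corner u) * free_lift scalar_op (var_op l) f =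
     free_lift scalar_op (var_op l) (free_act u f) * shift_op (corner u)"
proof (induction f rule: free_alg_induct)
  case (const a)
  show ?case
    by (simp, rule endo_eqI, rule ext) (simp add: apply_shift_op apply_scalar_op)
next
  case (var i f)
  have "shift_op (corner u) * var_op l i = free_lift scalar_op (var_op l) (lin_subst free_var u i) * shift_op (corner u)"
  proof (rule endo_eqI, rule ext)
    fix m a
    have "i = 1 \<or> i = 2" by (rule exhaust_2)
    then show "apply_endo (shift_op (corner u) * var_op l i) m a =
        apply_endo (free_lift scalar_op (var_op l) (lin_subst free_var u i) * shift_op (corner u)) m a"
      by (elim disjE)
         (simp_all add: lin_subst_def sum_2 G_unitriangular[OF u] var_op.lift_add var_op.lift_mult var_op_def
           apply_shift_op apply_scalar_op apply_x_op apply_y_op algebra_simps,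
          simp flip: smult_add_left)
  qed
  then show ?case
    by (simp add: var_op.lift_mult free_act.lift_mult mult.assoc flip: var)
       (simp flip: mult.assoc)
next
  case (add f g)
  then show ?case
    by (simp add: var_op.lift_add free_act.lift_add distrib_left distrib_right)
qed

lemma shift_op_add: "shift_op (a + b) = shift_op a * shift_op b"
  by (rule endo_eqI, rule ext) (simp add: apply_shift_op algebra_simps)

lemma smash_op_mult:
  assumes "Poly_Mapping.keys f \<subseteq> carrier G" "Poly_Mapping.keys g \<subseteq> carrier G"
  shows "smash_op l (f \<otimes>\<^bsub>free_skew\<^esub> g) = smash_op l f * smash_op l g"
  using assms(1)
proof (induction f rule: poly_mapping_induct_on)
  case (single u a)
  show ?case using assms(2)
  proof (induction g rule: poly_mapping_induct_on)
    case (single v b)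
    let ?L = "free_lift scalar_op (var_op l)"
    have "?L a * (?L (free_act u b) * shift_op (corner u)) * shift_op (corner v) =
        ?L a * (shift_op (corner u) * ?L b) * shift_op (corner v)"
      by (simp only: shift_op_commute[OF \<open>u \<in> carrier G\<close>])
    then show ?case
      using single \<open>u \<in> carrier G\<close>
      by (simp add: free_skew.smult_single smash_op_single var_op.lift_mult G_corner_mult shift_op_add mult.assoc)
  qed (simp_all add: free_skew.smult_add_right smash_op_add distrib_left)
qed (simp_all add: free_skew.smult_add_left smash_op_add distrib_right)

text \<open>Multiplication by y + a x commutes with multiplication by x, so the commutator comes
  only from the derivative part of \<open>y_op\<close>. The product rule, d/dx (x q) - x d/dx q = q,
  leaves exactly the action of \<open>l\<close>.\<close>

lemma smash_op_relator: "smash_op l (relator l) = 0"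
proof -
  have keys: "Poly_Mapping.keys (Poly_Mapping.map const l) = Poly_Mapping.keys l"
    by (auto simp: in_keys_iff lookup_map const_eq_0_iff)
  have "smash_op l (Poly_Mapping.map const l) =
      (\<Sum>v\<in>Poly_Mapping.keys l. scalar_op (Poly_Mapping.lookup l v) * shift_op (corner v))"
    by (simp add: smash_op_def keys lookup_map)
  moreover have "smash_op l (Poly_Mapping.single (mat 1) (free_var 1 * free_var 2 - free_var 2 * free_var 1)) =
      (\<Sum>v\<in>Poly_Mapping.keys l. scalar_op (Poly_Mapping.lookup l v) * shift_op (corner v))"
  proof (rule endo_eqI, rule ext)
    fix m :: "'a pbw_module" and a
    have sum_apply: "sum F I a = (\<Sum>i\<in>I. F i a)" for F :: "'i \<Rightarrow> 'a pbw_module" and I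
      by (induction I rule: infinite_finite_induct) simp_all
    \<comment> \<open>A name for the outer variable keeps it from being multiplied out, so that the
      product rule applies to it as a single factor.\<close>
    define X :: "'a poly poly" where "X = [:0, 1:]"
    have x: "apply_endo x_op m' = (\<lambda>a. X * m' a)" for m'
      by (simp add: apply_x_op X_def)
    have "pderiv (X * q) = q + X * pderiv q" for q
      by (simp add: X_def pderiv_pCons)
    then show "apply_endo (smash_op l (Poly_Mapping.single (mat 1) (free_var 1 * free_var 2 - free_var 2 * free_var 1))) m a =
      apply_endo (\<Sum>v\<in>Poly_Mapping.keys l. scalar_op (Poly_Mapping.lookup l v) * shift_op (corner v)) m a"
      by (simp add: smash_op_single var_op.lift_diff var_op.lift_mult var_op_def mat_def apply_shift_op
          apply_endo_sum sum_apply x apply_y_op apply_scalar_op sum_distrib_left smult_add_right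
          distrib_left sum.distrib mult.left_commute del: mult_pCons_left)
  qed
  ultimately show ?thesis
    by (simp add: relator_def smash_op_diff)
qed

lemma H_ideal_smash_op:
  assumes "l \<in> group_algebra G" "f \<in> H_ideal l"
  shows "smash_op l f = 0"
  by (rule H_ideal_kernel[OF assms]) (auto simp: smash_op_add smash_op_mult smash_op_relator)


section \<open>Normal words\<close>

definition normal_word :: "(2 \<Rightarrow>\<^sub>0 nat) \<Rightarrow> 2 free_monoid" where
  "normal_word e = Word (replicate (Poly_Mapping.lookup e 2) 2 @ replicate (Poly_Mapping.lookup e 1) 1)"

text \<open>A linear, not multiplicative, section of \<open>abelianize\<close>: among all words with
  the same commutative image it selects the normal one.\<close>

definition normal_lift :: "'k::field poly_alg \<Rightarrow> 'k free_alg" where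
  "normal_lift q = (\<Sum>e\<in>Poly_Mapping.keys q. Poly_Mapping.single (normal_word e) (Poly_Mapping.lookup q e))"

lemma normal_lift_add: "normal_lift (p + q) = normal_lift p + normal_lift q"
  unfolding normal_lift_def by (rule setsum_keys_plus_distrib) (simp_all add: single_add)

lemma normal_lift_0 [simp]: "normal_lift 0 = 0"
  by (simp add: normal_lift_def)

lemma normal_lift_single: "normal_lift (Poly_Mapping.single e c) = Poly_Mapping.single (normal_word e) c"
  unfolding normal_lift_def by (rule sum_keys_single) simp

lemma free_var_power: "free_var i ^ n = Poly_Mapping.single (Word (replicate n i)) 1"
  by (induction n) (simp_all add: free_var_def mult_single plus_free_monoid_def flip: zero_free_monoid_def)

lemma poly_var_power: "poly_var i ^ n = Poly_Mapping.single (Poly_Mapping.single i n) 1"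
  by (induction n) (simp_all add: poly_var_def mult_single flip: single_add)

lemma single_normal_word:
  "Poly_Mapping.single (normal_word e) c =
     const c * (free_var 2 ^ Poly_Mapping.lookup e 2 * free_var 1 ^ Poly_Mapping.lookup e 1)"
  by (simp add: free_var_power const_def mult_single plus_free_monoid_def zero_free_monoid_def normal_word_def)

lemma exponent_eq: "Poly_Mapping.single 2 (Poly_Mapping.lookup e 2) + Poly_Mapping.single 1 (Poly_Mapping.lookup e 1) = (e :: 2 \<Rightarrow>\<^sub>0 nat)"
proof (rule poly_mapping_eqI)
  fix k :: 2
  show "Poly_Mapping.lookup (Poly_Mapping.single 2 (Poly_Mapping.lookup e 2) +
      Poly_Mapping.single 1 (Poly_Mapping.lookup e 1)) k = Poly_Mapping.lookup e k"
    using exhaust_2[of k] by (auto simp: lookup_add lookup_single)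
qed

lemma abelianize_normal_lift: "abelianize (normal_lift q) = q"
proof (induction q rule: poly_mapping_induct)
  case (single e c)
  then show ?case
    by (simp add: normal_lift_single single_normal_word abelianize.lift_mult abelianize.lift_power poly_var_power)
       (simp add: const_def mult_single exponent_eq)
qed (simp_all add: normal_lift_add abelianize.lift_add)

lemma normal_lift_deg_in: "q \<in> deg_in poly_deg S \<Longrightarrow> normal_lift q \<in> deg_in free_deg S"
proof -
  assume "q \<in> deg_in poly_deg S"
  then have "Poly_Mapping.keys q \<subseteq> {e. poly_deg e \<in> S}"
    by (auto simp: deg_in_def)
  then show ?thesis
  proof (induction q rule: poly_mapping_induct_on)
    case (single e c)
    then show ?case
      by (auto simp: normal_lift_single normal_word_def poly_deg_def sum_2 add.commute intro!: deg_in_single)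
  qed (simp_all add: normal_lift_add deg_in_add)
qed

text \<open>On functions supported at 0 whose values do not involve x, \<open>y_op\<close> is plain
  multiplication by y: the term a x vanishes at a = 0, and the derivative with respect to x kills
  every value.\<close>

lemma apply_y_op_power:
  "apply_endo (y_op l ^ n) (\<lambda>a. if a = 0 then [:[:c:]:] else 0) = (\<lambda>a. if a = 0 then [:monom c n:] else 0)"
proof (induction n)
  case (Suc n)
  have "y_op l ^ Suc n = y_op l ^ n * y_op l"
    by (simp add: power_commutes)
  then show ?case
    by (simp only: apply_endo_simps Suc) (auto simp: apply_y_op fun_eq_iff monom_Suc pderiv_pCons intro!: sum.neutral)
qed (auto simp: monom_0 fun_eq_iff)

lemma apply_x_op_power:
  "apply_endo (x_op ^ n) (\<lambda>a. if a = 0 then [:c:] else 0) = (\<lambda>a. if a = 0 then monom c n else 0)"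
proof (induction n)
  case (Suc n)
  have "x_op ^ Suc n = x_op ^ n * (x_op :: 'a pbw_module endo)"
    by (simp add: power_commutes)
  then show ?case
    by (simp only: apply_endo_simps Suc) (auto simp: apply_x_op fun_eq_iff monom_Suc)
qed (auto simp: monom_0 fun_eq_iff)

text \<open>Hence the elements \<open>y\<^sup>j x\<^sup>i u\<close> are linearly independent in \<open>H\<^sub>\<lambda>\<close>.\<close>

lemma coeff_smash_op_normal_lift:
  assumes "q \<in> smash_deg_in poly_deg UNIV" "u \<in> carrier G"
  shows "coeff (coeff (apply_endo (smash_op l (Poly_Mapping.map normal_lift q)) (\<lambda>a. if a = 0 then 1 else 0) (corner u))
     (Poly_Mapping.lookup e 1)) (Poly_Mapping.lookup e 2) = Poly_Mapping.lookup (Poly_Mapping.lookup q u) e"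
  using assms(1)
proof (induction q rule: smash_deg_in_induct)
  case (single v e' c)
  have "e = e' \<longleftrightarrow> Poly_Mapping.lookup e 1 = Poly_Mapping.lookup e' 1 \<and> Poly_Mapping.lookup e 2 = Poly_Mapping.lookup e' 2"
    by (metis exponent_eq)
  moreover have "apply_endo (scalar_op c) (\<lambda>a. if a = 0 then 1 else 0) = (\<lambda>a. if a = 0 then [:[:c:]:] else 0)"
    by (auto simp: apply_scalar_op one_pCons)
  moreover have "Poly_Mapping.map normal_lift (Poly_Mapping.single v (Poly_Mapping.single e' c)) =
      Poly_Mapping.single v (Poly_Mapping.single (normal_word e') c)"
    by (simp add: normal_lift_single)
  ultimately show ?case
    \<comment> \<open>The word y^j x^i v sends the unit vector at 0 to y^j x^i placed at the index
      \<open>corner v\<close>. Different elements of G have different indices, so a coefficient at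
      \<open>corner u\<close> sees only the words ending in u.\<close>
    using G_eq_iff[OF assms(2) single(1)]
    by (auto simp: smash_op_single single_normal_word var_op.lift_mult var_op.lift_power var_op_def
        apply_y_op_power apply_x_op_power apply_shift_op lookup_single when_def simp del: map_single)
next
  case (add f g)
  then show ?case
    by (simp add: map_plus[OF normal_lift_add] smash_op_add lookup_add)
qed simp_all


section \<open>Reduction to normal form\<close>

interpretation poly_act: additive_action G poly_act
  by standard (simp add: poly_act_def poly_subst_add)

abbreviation smash_abelianize :: "'k::field free_smash \<Rightarrow> 'k poly_smash" where
  "smash_abelianize \<equiv> Poly_Mapping.map abelianize"

abbreviation smash_normal_lift :: "'k::field poly_smash \<Rightarrow> 'k free_smash" where
  "smash_normal_lift \<equiv> Poly_Mapping.map normal_lift"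

lemma smash_abelianize_add: "smash_abelianize (f + g) = smash_abelianize f + smash_abelianize g"
  by (rule map_plus) (rule abelianize.lift_add)

lemma smash_abelianize_diff: "smash_abelianize (f - g) = smash_abelianize f - smash_abelianize g"
  using smash_abelianize_add[of "f - g" g] by simp

lemma smash_normal_lift_add: "smash_normal_lift (p + q) = smash_normal_lift p + smash_normal_lift q"
  by (rule map_plus) (rule normal_lift_add)

lemma smash_normal_lift_diff: "smash_normal_lift (p - q) = smash_normal_lift p - smash_normal_lift q"
  using smash_normal_lift_add[of "p - q" q] by simp

lemma smash_abelianize_normal_lift: "smash_abelianize (smash_normal_lift q) = q"
  by (rule poly_mapping_eqI) (simp add: lookup_map abelianize_normal_lift)

lemma smash_abelianize_deg_in:
  assumes "f \<in> smash_deg_in free_deg S"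
  shows "smash_abelianize f \<in> smash_deg_in poly_deg S"
  using assms order_trans[OF keys_map_subset smash_deg_in_keys[OF assms]]
  by (simp add: smash_deg_in_def lookup_map abelianize_deg_in)

lemma smash_normal_lift_deg_in:
  assumes "q \<in> smash_deg_in poly_deg S"
  shows "smash_normal_lift q \<in> smash_deg_in free_deg S"
  using assms order_trans[OF keys_map_subset smash_deg_in_keys[OF assms]]
  by (simp add: smash_deg_in_def lookup_map normal_lift_deg_in)

lemma smash_abelianize_part:
  "smash_abelianize (smash_part free_deg n f) = smash_part poly_deg n (smash_abelianize f)"
  by (rule poly_mapping_eqI) (simp add: lookup_map abelianize_hom_part)

lemma smash_abelianize_mult:
  "smash_abelianize (f \<otimes>\<^bsub>free_skew\<^esub> g) = smash_abelianize f \<otimes>\<^bsub>smash_product G poly_act\<^esub> smash_abelianize g"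
proof (induction f rule: poly_mapping_induct)
  case (single u a)
  show ?case
  proof (induction g rule: poly_mapping_induct)
    case (single v b)
    have map: "smash_abelianize (Poly_Mapping.single w c) = Poly_Mapping.single w (abelianize c)" for w and c :: "'a free_alg"
      by (cases "c = 0") simp_all
    show ?case
      by (simp add: free_skew.smult_single poly_act.smult_single map abelianize.lift_mult abelianize_free_act del: map_single)
  qed (simp_all add: free_skew.smult_add_right poly_act.smult_add_right smash_abelianize_add)
qed (simp_all add: free_skew.smult_add_left poly_act.smult_add_left smash_abelianize_add)

locale deformation =
  fixes l :: "'k::field^2^2 \<Rightarrow>\<^sub>0 'k"
  assumes in_group_algebra: "l \<in> group_algebra G"
begin

interpretation F: ring "free_skew :: 'k free_smash ring"
  by (rule ring_free_skew)

interpretation I: ideal "H_ideal l" free_skew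
  by (rule ideal_H_ideal[OF in_group_algebra])

lemma ideal_keys: "f \<in> H_ideal l \<Longrightarrow> Poly_Mapping.keys f \<subseteq> carrier G"
  using I.a_Hcarr[of f] by simp

lemma ideal_deg_in: "f \<in> H_ideal l \<Longrightarrow> f \<in> smash_deg_in free_deg UNIV"
  using ideal_keys by (simp add: smash_deg_in_UNIV)

lemma ideal_0: "0 \<in> H_ideal l"
  using I.zero_closed by simp

lemma ideal_add: "f \<in> H_ideal l \<Longrightarrow> g \<in> H_ideal l \<Longrightarrow> f + g \<in> H_ideal l"
  using I.a_closed[of f g] by simp

lemma ideal_diff: "f \<in> H_ideal l \<Longrightarrow> g \<in> H_ideal l \<Longrightarrow> f - g \<in> H_ideal l"
  using ideal_add[of f "- g"] I.a_inv_closed[of g] by (simp add: free_skew_minus ideal_keys)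

lemma relator_in_ideal: "relator l \<in> H_ideal l"
  unfolding H_ideal_def using relator_closed[OF in_group_algebra]
  by (intro F.genideal_self') simp

text \<open>The preimage of \<open>filt_prev (H l) (H_filt l) n\<close> in the free smash product.\<close>

definition low :: "nat \<Rightarrow> 'k free_smash set" where
  "low n = {f + g | f g. f \<in> H_ideal l \<and> g \<in> smash_deg_in free_deg {..<n}}"

lemma lowI: "f \<in> H_ideal l \<Longrightarrow> g \<in> smash_deg_in free_deg {..<n} \<Longrightarrow> f + g \<in> low n"
  by (auto simp: low_def)

lemma lowE:
  assumes "h \<in> low n"
  obtains f g where "h = f + g" "f \<in> H_ideal l" "g \<in> smash_deg_in free_deg {..<n}"
  using assms by (auto simp: low_def)

lemma ideal_in_low: "f \<in> H_ideal l \<Longrightarrow> f \<in> low n"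
  using lowI[of f 0] by simp

lemma deg_in_low: "g \<in> smash_deg_in free_deg {..<n} \<Longrightarrow> g \<in> low n"
  using lowI[of 0 g] ideal_0 by simp

lemma low_0 [simp]: "0 \<in> low n"
  by (rule ideal_in_low) (rule ideal_0)

lemma low_add: "f \<in> low n \<Longrightarrow> g \<in> low n \<Longrightarrow> f + g \<in> low n"
proof (elim lowE)
  fix f1 f2 g1 g2
  assume *: "f = f1 + f2" "g = g1 + g2" "f1 \<in> H_ideal l" "g1 \<in> H_ideal l"
    "f2 \<in> smash_deg_in free_deg {..<n}" "g2 \<in> smash_deg_in free_deg {..<n}"
  have "(f1 + g1) + (f2 + g2) \<in> low n"
    by (intro lowI ideal_add smash_deg_in_add *)
  then show "f + g \<in> low n"
    by (simp add: * add_ac)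
qed

lemma low_mono: "f \<in> low m \<Longrightarrow> m \<le> n \<Longrightarrow> f \<in> low n"
  by (erule lowE) (auto intro!: lowI elim: smash_deg_in_mono)

lemma low_mult_left:
  assumes "h \<in> smash_deg_in free_deg {..k}" "f \<in> low n"
  shows "h \<otimes>\<^bsub>free_skew\<^esub> f \<in> low (n + k)"
  using assms(2)
proof (rule lowE)
  fix f1 f2
  assume f: "f = f1 + f2" "f1 \<in> H_ideal l" "f2 \<in> smash_deg_in free_deg {..<n}"
  have "h \<otimes>\<^bsub>free_skew\<^esub> f1 \<in> H_ideal l"
    using f(2) smash_deg_in_keys[OF assms(1)] by (simp add: I.I_l_closed)
  moreover have "h \<otimes>\<^bsub>free_skew\<^esub> f2 \<in> smash_deg_in free_deg {..<n + k}"
    by (rule free_skew_mult_deg_in[OF assms(1) f(3)]) auto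
  ultimately show ?thesis
    by (simp add: f(1) free_skew.smult_add_right lowI)
qed

lemma low_mult_right:
  assumes "h \<in> smash_deg_in free_deg {..k}" "f \<in> low n"
  shows "f \<otimes>\<^bsub>free_skew\<^esub> h \<in> low (n + k)"
  using assms(2)
proof (rule lowE)
  fix f1 f2
  assume f: "f = f1 + f2" "f1 \<in> H_ideal l" "f2 \<in> smash_deg_in free_deg {..<n}"
  have "f1 \<otimes>\<^bsub>free_skew\<^esub> h \<in> H_ideal l"
    using f(2) smash_deg_in_keys[OF assms(1)] by (simp add: I.I_r_closed)
  moreover have "f2 \<otimes>\<^bsub>free_skew\<^esub> h \<in> smash_deg_in free_deg {..<n + k}"
    by (rule free_skew_mult_deg_in[OF f(3) assms(1)]) auto
  ultimately show ?thesis
    by (simp add: f(1) free_skew.smult_add_left lowI)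
qed

section \<open>Rewriting words modulo lower degree\<close>

abbreviation emb :: "'k free_alg \<Rightarrow> 'k free_smash" where
  "emb \<equiv> Poly_Mapping.single (mat 1)"

lemma emb_mult: "emb (a * b) = emb a \<otimes>\<^bsub>free_skew\<^esub> emb b"
  by (simp add: free_skew.smult_single free_act_mat_1)

lemma emb_mult_low:
  assumes "a \<in> deg_in free_deg {..k}" "emb b \<in> low n"
  shows "emb (a * b) \<in> low (n + k)" "emb (b * a) \<in> low (n + k)"
proof -
  have "emb a \<in> smash_deg_in free_deg {..k}"
    using assms(1) by (simp add: smash_deg_in_single)
  then show "emb (a * b) \<in> low (n + k)" "emb (b * a) \<in> low (n + k)"
    unfolding emb_mult using assms(2) by (simp_all only: low_mult_left low_mult_right)
qed

lemma free_var_power_deg_in: "free_var i ^ n \<in> deg_in free_deg {..n}"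
  by (simp add: free_var_power deg_in_single)

text \<open>Split x y^(j+1) - y^(j+1) x as (x y - y x) y^j + y (x y^j - y^j x). The factor x y - y x
  is the relator plus \<lambda>, and \<lambda> has degree 0, below the degree 2 of x y; the second
  summand is the induction hypothesis.\<close>

lemma emb_commutator_low:
  "emb (free_var 1 * free_var 2 ^ j - free_var 2 ^ j * free_var 1) \<in> low (Suc j)"
proof (induction j)
  case (Suc j)
  let ?x = "free_var 1 :: 'k free_alg" and ?y = "free_var 2 :: 'k free_alg"
  have const_low: "Poly_Mapping.map const l \<in> smash_deg_in free_deg {..<2}"
    using in_group_algebra order_trans[OF keys_map_subset[of const l], of "carrier G"]
    by (auto simp: smash_deg_in_def lookup_map const_def group_algebra_def intro!: deg_in_single)
  have "emb (?x * ?y - ?y * ?x) = relator l + Poly_Mapping.map const l"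
    by (simp add: relator_def)
  then have "emb (?x * ?y - ?y * ?x) \<in> low 2"
    using lowI[OF relator_in_ideal const_low] by simp
  from emb_mult_low(2)[OF free_var_power_deg_in this, of 2 j] 
  have "emb ((?x * ?y - ?y * ?x) * ?y ^ j) \<in> low (Suc (Suc j))"
    by simp
  moreover have "emb (?y * (?x * ?y ^ j - ?y ^ j * ?x)) \<in> low (Suc (Suc j))"
    using emb_mult_low(1)[OF free_var_power_deg_in Suc, of 2 1] by simp
  ultimately have "emb ((?x * ?y - ?y * ?x) * ?y ^ j) + emb (?y * (?x * ?y ^ j - ?y ^ j * ?x)) \<in> low (Suc (Suc j))"
    by (rule low_add)
  then show ?case
    by (simp add: left_diff_distrib right_diff_distrib mult.assoc flip: single_add)
qed simp

text \<open>Prepending y to a normal word leaves it normal. A prepended x has to move past y^j,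
  which \<open>emb_commutator_low\<close> permits up to terms of lower degree.\<close>

lemma word_normal_form:
  "\<exists>i j. i + j = length w \<and> abelianize (Poly_Mapping.single (Word w) (1 :: 'k)) = poly_var 2 ^ j * poly_var 1 ^ i \<and>
     emb (Poly_Mapping.single (Word w) 1 - free_var 2 ^ j * free_var 1 ^ i) \<in> low (length w)"
proof (induction w)
  case Nil
  show ?case by (rule exI[of _ 0], rule exI[of _ 0]) (simp flip: zero_free_monoid_def)
next
  case (Cons k w)
  let ?x = "free_var 1 :: 'k free_alg" and ?y = "free_var 2 :: 'k free_alg"
  let ?w = "Poly_Mapping.single (Word w) 1 :: 'k free_alg"
  from Cons obtain i j where ij: "i + j = length w" 
    and ab: "abelianize ?w = poly_var 2 ^ j * poly_var 1 ^ i"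
    and w: "emb (?w - ?y ^ j * ?x ^ i) \<in> low (length w)"
    by auto
  have Cons_w: "Poly_Mapping.single (Word (k # w)) 1 = free_var k * ?w"
    by (simp add: free_var_def mult_single plus_free_monoid_def)
  have kw: "emb (free_var k * (?w - ?y ^ j * ?x ^ i)) \<in> low (Suc (length w))"
    using emb_mult_low(1)[OF free_var_power_deg_in w, of k 1] by simp
  show ?case
  proof (cases "k = 1")
    case True
    have "emb ((?x * ?y ^ j - ?y ^ j * ?x) * ?x ^ i) \<in> low (Suc j + i)"
      by (rule emb_mult_low(2)[OF free_var_power_deg_in emb_commutator_low])
    then have "emb ((?x * ?y ^ j - ?y ^ j * ?x) * ?x ^ i) \<in> low (Suc (length w))"
      using ij by (simp add: add.commute)
    from low_add[OF kw this]
    have "emb (free_var k * ?w - ?y ^ j * ?x ^ Suc i) \<in> low (Suc (length w))"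
      using True by (simp add: left_diff_distrib right_diff_distrib mult.assoc flip: single_add)
    then show ?thesis
      using True ij ab unfolding Cons_w
      by (intro exI[of _ "Suc i"] exI[of _ j]) (simp add: abelianize.lift_mult mult_ac)
  next
    case False
    then have "k = 2" using exhaust_2[of k] by simp
    then show ?thesis
      using kw ij ab unfolding Cons_w
      by (intro exI[of _ i] exI[of _ "Suc j"]) (simp add: abelianize.lift_mult right_diff_distrib mult_ac mult.assoc)
  qed
qed

lemma normal_form_low:
  assumes "f \<in> smash_deg_in free_deg {..n}"
  shows "f - smash_normal_lift (smash_abelianize f) \<in> low n"
  using assms
proof (induction f rule: smash_deg_in_induct)
  case (single u v c)
  let ?w = "Poly_Mapping.single v 1 :: 'k free_alg"
  obtain i j where ij: "abelianize ?w = poly_var 2 ^ j * poly_var 1 ^ i"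
    "emb (?w - free_var 2 ^ j * free_var 1 ^ i) \<in> low (free_deg v)"
    using word_normal_form[of "letters v"] by (auto simp: free_deg_def)
  define e where "e = Poly_Mapping.single 2 j + Poly_Mapping.single (1::2) i"
  have e: "Poly_Mapping.lookup e 2 = j" "Poly_Mapping.lookup e 1 = i"
    by (simp_all add: e_def lookup_add lookup_single)
  have cw: "Poly_Mapping.single v c = const c * ?w"
    by (simp add: const_def mult_single)
  have "abelianize (Poly_Mapping.single v c) = Poly_Mapping.single e c"
    by (simp add: cw abelianize.lift_mult ij poly_var_power mult_single e_def) (simp add: const_def mult_single)
  then have "smash_normal_lift (smash_abelianize (Poly_Mapping.single u (Poly_Mapping.single v c))) =
      Poly_Mapping.single u (const c * (free_var 2 ^ j * free_var 1 ^ i))"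
    by (simp add: normal_lift_single single_normal_word e)
  \<comment> \<open>The scalar and the group element split off as a right factor of degree 0, and
    multiplication by such a factor preserves \<open>low\<close>.\<close>
  then have "Poly_Mapping.single u (Poly_Mapping.single v c) -
      smash_normal_lift (smash_abelianize (Poly_Mapping.single u (Poly_Mapping.single v c))) =
      emb (?w - free_var 2 ^ j * free_var 1 ^ i) \<otimes>\<^bsub>free_skew\<^esub> Poly_Mapping.single u (const c)"
    by (simp add: free_skew.smult_single free_act_mat_1 cw right_diff_distrib flip: single_diff const_commute)
  moreover have "Poly_Mapping.single u (const c) \<in> smash_deg_in free_deg {..0}"
    using single(1) by (simp add: smash_deg_in_single deg_in_single const_def)
  ultimately show ?case
    using low_mono[OF low_mult_right[OF _ ij(2)], of _ 0 n] single(2) by simp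
next
  case (add f g)
  from low_add[OF this] show ?case
    by (simp add: smash_abelianize_add smash_normal_lift_add algebra_simps)
qed simp

text \<open>Each application of \<open>normal_form_low\<close> leaves a remainder of strictly
  smaller degree, and nothing but 0 lies below degree 0. In the end the only error is an element of
  the ideal.\<close>

lemma normal_form_exists:
  assumes "f \<in> smash_deg_in free_deg {..<n}"
  obtains q where "q \<in> smash_deg_in poly_deg {..<n}" "f - smash_normal_lift q \<in> H_ideal l"
  using assms
proof (induction n arbitrary: f thesis)
  case 0
  then show ?case using ideal_0 by (simp add: smash_deg_in_empty)
next
  case (Suc n)
  then have f: "f \<in> smash_deg_in free_deg {..n}"
    by (simp add: lessThan_Suc_atMost)
  from normal_form_low[OF f] obtain g h where gh:
    "f - smash_normal_lift (smash_abelianize f) = g + h" "g \<in> H_ideal l" "h \<in> smash_deg_in free_deg {..<n}"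
    by (rule lowE)
  obtain q where q: "q \<in> smash_deg_in poly_deg {..<n}" "h - smash_normal_lift q \<in> H_ideal l"
    using Suc.IH gh(3) by blast
  have "smash_abelianize f + q \<in> smash_deg_in poly_deg {..<Suc n}"
    using q(1) smash_abelianize_deg_in[OF f]
    by (intro smash_deg_in_add) (auto elim!: smash_deg_in_mono)
  moreover have "f - smash_normal_lift (smash_abelianize f + q) = g + (h - smash_normal_lift q)"
    using gh(1) by (simp add: smash_normal_lift_add algebra_simps)
  ultimately show ?case
    using Suc.prems(1) ideal_add[OF gh(2) q(2)] by simp
qed

text \<open>Elements of the ideal act as 0 on the module, whereas the image of the unit vector under
  the operator of a normal form displays all its coefficients.\<close>

lemma normal_form_unique:
  assumes "q \<in> smash_deg_in poly_deg UNIV" "smash_normal_lift q \<in> H_ideal l"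
  shows "q = 0"
proof -
  have "Poly_Mapping.lookup (Poly_Mapping.lookup q u) e = 0" for u e
  proof (cases "u \<in> carrier G")
    case True
    then show ?thesis
      using coeff_smash_op_normal_lift[OF assms(1) True, of l e]
        H_ideal_smash_op[OF in_group_algebra assms(2)] by simp
  next
    case False
    then show ?thesis
      using smash_deg_in_keys[OF assms(1)] by (metis in_keys_iff lookup_zero subsetD)
  qed
  then show ?thesis by (intro poly_mapping_eqI) simp
qed

text \<open>From right to left this is \<open>normal_form_low\<close>. Conversely, if f is low, then
  so is the normal form of its abelianization; modulo the ideal that normal form equals one of
  degree below n, and uniqueness makes the two coincide.\<close>

theorem low_iff:
  assumes f: "f \<in> smash_deg_in free_deg {..n}"
  shows "f \<in> low n \<longleftrightarrow> smash_abelianize f \<in> smash_deg_in poly_deg {..<n}"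
proof
  assume "smash_abelianize f \<in> smash_deg_in poly_deg {..<n}"
  from low_add[OF normal_form_low[OF f] deg_in_low[OF smash_normal_lift_deg_in[OF this]]]
  show "f \<in> low n" by simp
next
  assume "f \<in> low n"
  then obtain g h where gh: "f = g + h" "g \<in> H_ideal l" "h \<in> smash_deg_in free_deg {..<n}"
    by (rule lowE)
  from normal_form_low[OF f] obtain g' h' where gh':
    "f - smash_normal_lift (smash_abelianize f) = g' + h'" "g' \<in> H_ideal l" "h' \<in> smash_deg_in free_deg {..<n}"
    by (rule lowE)
  obtain q where q: "q \<in> smash_deg_in poly_deg {..<n}" "(h - h') - smash_normal_lift q \<in> H_ideal l"
    using normal_form_exists[OF smash_deg_in_diff[OF gh(3) gh'(3)]] .
  have "smash_normal_lift (smash_abelianize f - q) = (g - g') + ((h - h') - smash_normal_lift q)"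
    using gh(1) gh'(1) by (simp add: smash_normal_lift_diff algebra_simps)
  then have "smash_normal_lift (smash_abelianize f - q) \<in> H_ideal l"
    by (simp only: ideal_add[OF ideal_diff[OF gh(2) gh'(2)] q(2)])
  moreover have "smash_abelianize f - q \<in> smash_deg_in poly_deg UNIV"
    using smash_abelianize_deg_in[OF f] q(1) by (intro smash_deg_in_diff) (auto elim: smash_deg_in_mono)
  ultimately have "smash_abelianize f - q = 0"
    by (intro normal_form_unique)
  then show "smash_abelianize f \<in> smash_deg_in poly_deg {..<n}"
    using q(1) by simp
qed

end

interpretation undeformed: deformation "0 :: 'k::field^2^2 \<Rightarrow>\<^sub>0 'k"
  by standard (simp add: group_algebra_def)

text \<open>The undeformed relator is a commutator and dies under abelianization. Conversely,
  \<open>low_iff\<close> replaces an element with zero abelianization, modulo the ideal, by one of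
  smaller degree whose abelianization is again zero.\<close>

lemma H_ideal_0_iff:
  assumes "f \<in> smash_deg_in free_deg UNIV"
  shows "f \<in> H_ideal 0 \<longleftrightarrow> smash_abelianize f = 0"
proof
  show ab: "smash_abelianize f = 0" if "f \<in> H_ideal 0" for f :: "'a free_smash"
  proof (rule H_ideal_kernel[OF undeformed.in_group_algebra that])
    show "smash_abelianize (relator (0 :: 'a^2^2 \<Rightarrow>\<^sub>0 'a)) = 0"
      by (simp add: relator_def abelianize.lift_diff abelianize.lift_mult mult.commute)
  qed (auto simp: smash_abelianize_add smash_abelianize_mult)
  assume "smash_abelianize f = 0"
  obtain n where "f \<in> smash_deg_in free_deg {..<n}"
    using smash_deg_in_bounded[OF assms] by (metis lessThan_Suc_atMost)
  then show "f \<in> H_ideal 0"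
    using \<open>smash_abelianize f = 0\<close>
  proof (induction n arbitrary: f)
    case 0
    then show ?case using undeformed.ideal_0 by (simp add: smash_deg_in_empty)
  next
    case (Suc n)
    then have "f \<in> undeformed.low n"
      using undeformed.low_iff[of f n] by (simp add: lessThan_Suc_atMost)
    then obtain g h where gh: "f = g + h" "g \<in> H_ideal 0" "h \<in> smash_deg_in free_deg {..<n}"
      by (rule undeformed.lowE)
    then have "smash_abelianize h = 0"
      using Suc.prems(2) ab[OF gh(2)] by (simp add: smash_abelianize_add)
    then show ?case
      using Suc.IH[OF gh(3)] gh by (simp add: undeformed.ideal_add)
  qed
qed


section \<open>The associated graded ring of a filtered ring\<close>

lemma (in abelian_subgroup) a_coset_eq_iff:
  assumes "x \<in> carrier G" "y \<in> carrier G"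
  shows "H +> x = H +> y \<longleftrightarrow> x \<ominus> y \<in> H"
proof
  assume "H +> x = H +> y"
  then have "x \<in> H +> y"
    using a_rcos_self[OF assms(1)] by simp
  then show "x \<ominus> y \<in> H"
    using a_rcos_module_imp[OF assms(2)] by (simp add: minus_eq)
next
  assume "x \<ominus> y \<in> H"
  then have "x \<in> H +> y"
    using a_rcos_module_rev[OF assms(2,1)] by (simp add: minus_eq)
  then show "H +> x = H +> y"
    using a_repr_independence[OF _ assms(2) a_subgroup] by simp
qed

text \<open>Passes from sums in the free smash product to products in the multiplicatively written
  components of gr. Additivity is asked on \<open>S\<close> only, because the symbol of degree n is
  applied to elements of degree at most n.\<close>

lemma (in comm_monoid) finprod_additive:
  fixes \<phi> :: "'c::comm_monoid_add \<Rightarrow> 'a"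
  assumes "finite A" "\<And>i. i \<in> A \<Longrightarrow> f i \<in> S"
    and S: "0 \<in> S" "\<And>x y. x \<in> S \<Longrightarrow> y \<in> S \<Longrightarrow> x + y \<in> S"
    and \<phi>: "\<And>x. x \<in> S \<Longrightarrow> \<phi> x \<in> carrier G" "\<phi> 0 = \<one>"
      "\<And>x y. x \<in> S \<Longrightarrow> y \<in> S \<Longrightarrow> \<phi> (x + y) = \<phi> x \<otimes> \<phi> y"
  shows "finprod G (\<lambda>i. \<phi> (f i)) A = \<phi> (sum f A)"
proof -
  have "sum f A \<in> S \<and> finprod G (\<lambda>i. \<phi> (f i)) A = \<phi> (sum f A)"
    using assms(1,2)
  proof (induction A rule: finite_induct)
    case (insert i A)
    then show ?case
      by (simp add: S \<phi> Pi_def)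
  qed (simp add: S \<phi>)
  then show ?thesis ..
qed

locale filtered_ring = ring R for R :: "'a ring" (structure) +
  fixes F :: "nat \<Rightarrow> 'a set"
  assumes filt_subgroup: "subgroup (F n) (add_monoid R)"
    and filt_mono: "F n \<subseteq> F (Suc n)"
    and filt_mult: "a \<in> F m \<Longrightarrow> b \<in> F n \<Longrightarrow> a \<otimes> b \<in> F (m + n)"
begin

lemma filt_carrier: "a \<in> F n \<Longrightarrow> a \<in> carrier R"
  using subgroup.mem_carrier[OF filt_subgroup] by fastforce

lemma zero_in_filt: "\<zero> \<in> F n"
  using subgroup.one_closed[OF filt_subgroup] by simp

lemma filt_prev_subgroup: "subgroup (filt_prev R F n) (add_monoid R)"
proof (cases n)
  case 0
  then show ?thesis using add.triv_subgroup by (simp add: filt_prev_def)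
next
  case (Suc m)
  then show ?thesis using filt_subgroup[of m] by (simp add: filt_prev_def)
qed

lemma filt_prev_subset: "filt_prev R F n \<subseteq> F n"
  using filt_mono zero_in_filt by (cases n) (auto simp: filt_prev_def)

lemma filt_prev_mult:
  assumes "a \<in> F m" "b \<in> filt_prev R F n"
  shows "a \<otimes> b \<in> filt_prev R F (m + n)" "b \<otimes> a \<in> filt_prev R F (n + m)"
proof -
  have "a \<otimes> b \<in> filt_prev R F (m + n) \<and> b \<otimes> a \<in> filt_prev R F (n + m)"
  proof (cases n)
    case 0
    then have "b = \<zero>" using assms(2) by (simp add: filt_prev_def)
    then show ?thesis
      using subgroup.one_closed[OF filt_prev_subgroup] filt_carrier[OF assms(1)] by simp
  next
    case (Suc k)
    then have "b \<in> F k" using assms(2) by (simp add: filt_prev_def)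
    then show ?thesis
      using filt_mult[OF assms(1), of b k] filt_mult[of b k a m] assms(1) Suc by (simp add: filt_prev_def)
  qed
  then show "a \<otimes> b \<in> filt_prev R F (m + n)" "b \<otimes> a \<in> filt_prev R F (n + m)" by auto
qed

lemma abelian_subgroup_filt_prev: "abelian_subgroup (filt_prev R F n) R"
  by (rule abelian_subgroupI2[OF a_comm_group filt_prev_subgroup])

lemma comm_group_gr_comp: "comm_group (gr_comp R F n)"
proof -
  have "comm_group ((add_monoid R)\<lparr>carrier := F n\<rparr>)"
  proof (rule group.group_comm_groupI)
    show "Group.group ((add_monoid R)\<lparr>carrier := F n\<rparr>)"
      by (rule add.subgroup_imp_group[OF filt_subgroup])
  qed (use a_comm filt_carrier in auto)
  moreover have "subgroup (filt_prev R F n) ((add_monoid R)\<lparr>carrier := F n\<rparr>)"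
    by (rule add.subgroup_incl[OF filt_prev_subgroup filt_subgroup filt_prev_subset])
  ultimately show ?thesis
    unfolding gr_comp_def by (rule comm_group.abelian_FactGroup)
qed

lemma carrier_gr_comp: "carrier (gr_comp R F n) = (+>) (filt_prev R F n) ` F n"
  by (simp add: gr_comp_def carrier_FactGroup a_r_coset_def r_coset_def)

lemma one_gr_comp: "\<one>\<^bsub>gr_comp R F n\<^esub> = filt_prev R F n"
  by (simp add: gr_comp_def)

lemma mult_gr_comp:
  assumes "a \<in> F n" "b \<in> F n"
  shows "(filt_prev R F n +> a) \<otimes>\<^bsub>gr_comp R F n\<^esub> (filt_prev R F n +> b) = filt_prev R F n +> (a \<oplus> b)"
proof -
  have "(filt_prev R F n +> a) \<otimes>\<^bsub>gr_comp R F n\<^esub> (filt_prev R F n +> b) =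
      (filt_prev R F n +> a) <+> (filt_prev R F n +> b)"
    by (simp add: gr_comp_def set_add_def set_mult_def)
  then show ?thesis
    using abelian_subgroup.a_rcos_sum[OF abelian_subgroup_filt_prev] assms filt_carrier by simp
qed

text \<open>Changing a by p and b by q changes the product by pq + pb + aq, which lies one step
  lower in the filtration. All cosets in the union are therefore equal.\<close>

lemma gr_mult_coset:
  assumes a: "a \<in> F m" and b: "b \<in> F n"
  shows "gr_mult R F m n (filt_prev R F m +> a) (filt_prev R F n +> b) = filt_prev R F (m + n) +> (a \<otimes> b)"
proof -
  have "filt_prev R F (m + n) +> (a' \<otimes> b') = filt_prev R F (m + n) +> (a \<otimes> b)"
    if a': "a' \<in> filt_prev R F m +> a" and b': "b' \<in> filt_prev R F n +> b" for a' b'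
  proof -
    from a' b' obtain p q where pq: "p \<in> filt_prev R F m" "q \<in> filt_prev R F n" "a' = p \<oplus> a" "b' = q \<oplus> b"
      by (auto simp: a_r_coset_def r_coset_def)
    have F: "p \<in> F m" "q \<in> F n"
      using pq filt_prev_subset by auto
    have carr: "a \<in> carrier R" "b \<in> carrier R" "p \<in> carrier R" "q \<in> carrier R"
      using a b F filt_carrier by auto
    then have "(a' \<otimes> b') \<ominus> (a \<otimes> b) = p \<otimes> q \<oplus> p \<otimes> b \<oplus> a \<otimes> q"
      unfolding pq(3,4) by algebra
    moreover have "p \<otimes> q \<in> filt_prev R F (m + n)" "p \<otimes> b \<in> filt_prev R F (m + n)" "a \<otimes> q \<in> filt_prev R F (m + n)"
      using filt_prev_mult a b pq F by auto
    ultimately have "(a' \<otimes> b') \<ominus> (a \<otimes> b) \<in> filt_prev R F (m + n)"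
      using subgroup.m_closed[OF filt_prev_subgroup[of "m + n"]] by simp
    then show ?thesis
      using carr unfolding pq(3,4)
      by (subst abelian_subgroup.a_coset_eq_iff[OF abelian_subgroup_filt_prev]) auto
  qed
  then have "gr_mult R F m n (filt_prev R F m +> a) (filt_prev R F n +> b) =
      (\<Union>a'\<in>filt_prev R F m +> a. \<Union>b'\<in>filt_prev R F n +> b. filt_prev R F (m + n) +> (a \<otimes> b))"
    unfolding gr_mult_def by (intro SUP_cong refl)
  \<comment> \<open>Both index sets are nonempty, so the union of the constant family is that
    constant and not the empty set.\<close>
  moreover have "a \<in> filt_prev R F m +> a" "b \<in> filt_prev R F n +> b"
    using abelian_subgroup.a_rcos_self[OF abelian_subgroup_filt_prev] a b filt_carrier by auto
  ultimately show ?thesis by blast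
qed

lemma carrier_gr:
  "carrier (gr R s F) =
     {a. (\<forall>n. a n \<in> carrier (gr_comp R F n)) \<and> finite {n. a n \<noteq> \<one>\<^bsub>gr_comp R F n\<^esub>}}"
  using comm_group_gr_comp
  by (simp add: gr_def carrier_sum_group comm_group.axioms(2) PiE_iff extensional_def)

end


section \<open>The associated graded algebra of \<open>H\<^sub>\<lambda>\<close>\<close>

context deformation
begin

interpretation F: ring "free_skew :: 'k free_smash ring"
  by (rule ring_free_skew)

interpretation I: ideal "H_ideal l" free_skew
  by (rule ideal_H_ideal[OF in_group_algebra])

interpretation Q: ring "H l"
  unfolding H_def by (rule I.quotient_is_ring)

lemma carrier_H: "carrier (H l) = H_class l ` smash_deg_in free_deg UNIV"
  by (auto simp: H_def H_class_def FactRing_def A_RCOSETS_def' smash_deg_in_UNIV)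

lemma H_class_hom: "H_class l \<in> ring_hom free_skew (H l)"
  using I.rcos_ring_hom by (simp add: H_def H_class_def[abs_def])

lemma H_class_add:
  "f \<in> smash_deg_in free_deg S \<Longrightarrow> g \<in> smash_deg_in free_deg T \<Longrightarrow> H_class l (f + g) = H_class l f \<oplus>\<^bsub>H l\<^esub> H_class l g"
  using ring_hom_add[OF H_class_hom, of f g] by (simp add: smash_deg_in_keys)

lemma H_class_mult:
  "f \<in> smash_deg_in free_deg S \<Longrightarrow> g \<in> smash_deg_in free_deg T \<Longrightarrow>
     H_class l (f \<otimes>\<^bsub>free_skew\<^esub> g) = H_class l f \<otimes>\<^bsub>H l\<^esub> H_class l g"
  using ring_hom_mult[OF H_class_hom, of f g] by (simp add: smash_deg_in_keys)

lemma H_class_one: "H_class l (Poly_Mapping.single (mat 1) 1) = \<one>\<^bsub>H l\<^esub>"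
  using ring_hom_one[OF H_class_hom] by simp

lemma H_class_zero: "H_class l 0 = \<zero>\<^bsub>H l\<^esub>"
  using ring_hom_zero[OF H_class_hom F.ring_axioms Q.ring_axioms] by simp

lemma H_class_eq_iff:
  assumes "f \<in> smash_deg_in free_deg S" "g \<in> smash_deg_in free_deg T"
  shows "H_class l f = H_class l g \<longleftrightarrow> f - g \<in> H_ideal l"
  using I.a_coset_eq_iff[of f g] smash_deg_in_keys[OF assms(1)] smash_deg_in_keys[OF assms(2)]
  by (simp add: H_class_def F.minus_eq free_skew_minus)

lemma H_class_in_carrier: "f \<in> smash_deg_in free_deg S \<Longrightarrow> H_class l f \<in> carrier (H l)"
  by (auto simp: carrier_H intro!: imageI elim: smash_deg_in_mono)

lemma H_class_minus:
  assumes "f \<in> smash_deg_in free_deg S" "g \<in> smash_deg_in free_deg T"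
  shows "H_class l (f - g) = H_class l f \<ominus>\<^bsub>H l\<^esub> H_class l g"
proof -
  have fg: "f - g \<in> smash_deg_in free_deg UNIV"
    using assms by (intro smash_deg_in_diff) (auto elim: smash_deg_in_mono)
  have "H_class l f = H_class l (f - g) \<oplus>\<^bsub>H l\<^esub> H_class l g"
    using H_class_add[OF fg assms(2)] by simp
  then show ?thesis
    using H_class_in_carrier[OF fg] H_class_in_carrier[OF assms(2)]
    by (simp add: Q.minus_eq Q.a_assoc Q.r_neg)
qed

lemma H_filt_eq: "H_filt l n = H_class l ` smash_deg_in free_deg {..n}"
  by (simp add: H_filt_def smash_upto_eq)

lemma filtered_ring_H: "filtered_ring (H l) (H_filt l)"
proof (intro filtered_ring.intro filtered_ring_axioms.intro)
  show "ring (H l)" by (rule Q.ring_axioms)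
  fix n
  show "subgroup (H_filt l n) (add_monoid (H l))"
  proof (rule Q.add.subgroupI)
    show "H_filt l n \<subseteq> carrier (H l)"
      by (auto simp: H_filt_eq H_class_in_carrier)
    show "H_filt l n \<noteq> {}"
      by (auto simp: H_filt_eq intro: smash_deg_in_0)
    fix a
    assume "a \<in> H_filt l n"
    then obtain f where f: "a = H_class l f" "f \<in> smash_deg_in free_deg {..n}"
      by (auto simp: H_filt_eq)
    have "\<ominus>\<^bsub>H l\<^esub> a = H_class l (0 - f)"
      using H_class_minus[OF smash_deg_in_0 f(2)] H_class_in_carrier[OF f(2)]
      by (simp add: f(1) H_class_zero Q.minus_eq)
    then show "\<ominus>\<^bsub>H l\<^esub> a \<in> H_filt l n"
      using smash_deg_in_diff[OF smash_deg_in_0 f(2)] unfolding H_filt_eq by blast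
    fix b
    assume "b \<in> H_filt l n"
    then obtain g where g: "b = H_class l g" "g \<in> smash_deg_in free_deg {..n}"
      by (auto simp: H_filt_eq)
    show "a \<oplus>\<^bsub>H l\<^esub> b \<in> H_filt l n"
      using f g smash_deg_in_add[OF f(2) g(2)] by (simp add: H_filt_eq flip: H_class_add)
  qed
  show "H_filt l n \<subseteq> H_filt l (Suc n)"
    by (auto simp: H_filt_eq intro!: imageI elim: smash_deg_in_mono)
next
  fix a b m n
  assume "a \<in> H_filt l m" "b \<in> H_filt l n"
  then obtain f g where fg: "a = H_class l f" "f \<in> smash_deg_in free_deg {..m}"
      "b = H_class l g" "g \<in> smash_deg_in free_deg {..n}"
    by (auto simp: H_filt_eq)
  have "f \<otimes>\<^bsub>free_skew\<^esub> g \<in> smash_deg_in free_deg {..m + n}"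
    by (rule free_skew_mult_deg_in[OF fg(2,4)]) auto
  then show "a \<otimes>\<^bsub>H l\<^esub> b \<in> H_filt l (m + n)"
    using fg by (simp add: H_filt_eq flip: H_class_mult)
qed

interpretation FR: filtered_ring "H l" "H_filt l"
  by (rule filtered_ring_H)

text \<open>The strict bound absorbs the convention for n = 0: \<open>{..<0}\<close> is empty and
  leaves only the zero class.\<close>

lemma filt_prev_H: "filt_prev (H l) (H_filt l) n = H_class l ` smash_deg_in free_deg {..<n}"
  by (cases n) (simp_all add: filt_prev_def smash_deg_in_empty H_class_zero H_filt_eq lessThan_Suc_atMost)

section \<open>Symbols and the natural map on the free smash product\<close>

definition symb :: "nat \<Rightarrow> 'k free_smash \<Rightarrow> 'k free_smash set set" where
  "symb n f = filt_prev (H l) (H_filt l) n +>\<^bsub>H l\<^esub> H_class l f"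

text \<open>Equality in gr H_\<lambda> thus becomes membership in \<open>low\<close>, which
  \<open>low_iff\<close> decides by abelianization.\<close>

lemma symb_eq_iff:
  assumes "f \<in> smash_deg_in free_deg S" "g \<in> smash_deg_in free_deg T"
  shows "symb n f = symb n g \<longleftrightarrow> f - g \<in> low n"
proof -
  have fg: "f - g \<in> smash_deg_in free_deg UNIV"
    using assms by (intro smash_deg_in_diff) (auto elim: smash_deg_in_mono)
  have "symb n f = symb n g \<longleftrightarrow> H_class l (f - g) \<in> H_class l ` smash_deg_in free_deg {..<n}"
    unfolding symb_def
    by (subst abelian_subgroup.a_coset_eq_iff[OF FR.abelian_subgroup_filt_prev])
       (use assms in \<open>auto simp: H_class_in_carrier filt_prev_H H_class_minus\<close>)
  also have "\<dots> \<longleftrightarrow> (\<exists>h\<in>smash_deg_in free_deg {..<n}. f - g - h \<in> H_ideal l)"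
    using H_class_eq_iff[OF fg] by blast
  also have "\<dots> \<longleftrightarrow> f - g \<in> low n"
  proof
    assume "\<exists>h\<in>smash_deg_in free_deg {..<n}. f - g - h \<in> H_ideal l"
    then obtain h where "h \<in> smash_deg_in free_deg {..<n}" "f - g - h \<in> H_ideal l" ..
    from lowI[OF this(2,1)] show "f - g \<in> low n" by simp
  next
    assume "f - g \<in> low n"
    then show "\<exists>h\<in>smash_deg_in free_deg {..<n}. f - g - h \<in> H_ideal l"
      by (rule lowE) (auto intro!: bexI)
  qed
  finally show ?thesis .
qed

lemma symb_0: "symb n 0 = \<one>\<^bsub>gr_comp (H l) (H_filt l) n\<^esub>"
  using abelian_subgroup.a_rcos_const[OF FR.abelian_subgroup_filt_prev subgroup.one_closed[OF FR.filt_prev_subgroup]]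
  by (simp add: symb_def H_class_zero FR.one_gr_comp)

lemma carrier_gr_comp_H:
  "carrier (gr_comp (H l) (H_filt l) n) = symb n ` smash_deg_in free_deg {..n}"
  by (simp add: FR.carrier_gr_comp H_filt_eq image_image symb_def)

lemma symb_add:
  assumes "f \<in> smash_deg_in free_deg {..n}" "g \<in> smash_deg_in free_deg {..n}"
  shows "symb n (f + g) = symb n f \<otimes>\<^bsub>gr_comp (H l) (H_filt l) n\<^esub> symb n g"
  unfolding symb_def H_class_add[OF assms]
  by (rule FR.mult_gr_comp[symmetric]) (use assms in \<open>auto simp: H_filt_eq\<close>)

lemma symb_mult:
  assumes "f \<in> smash_deg_in free_deg {..m}" "g \<in> smash_deg_in free_deg {..n}"
  shows "gr_mult (H l) (H_filt l) m n (symb m f) (symb n g) = symb (m + n) (f \<otimes>\<^bsub>free_skew\<^esub> g)"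
  unfolding symb_def H_class_mult[OF assms]
  by (rule FR.gr_mult_coset) (use assms in \<open>auto simp: H_filt_eq\<close>)

text \<open>Every homogeneous part contributes, not just the top one: this is the natural map to gr
  H_\<lambda>, taken before passing to the quotient H_0.\<close>

definition leading :: "'k free_smash \<Rightarrow> nat \<Rightarrow> 'k free_smash set set" where
  "leading f = (\<lambda>n. symb n (smash_part free_deg n f))"

lemma part_deg_in: "f \<in> smash_deg_in free_deg UNIV \<Longrightarrow> smash_part free_deg n f \<in> smash_deg_in free_deg {..n}"
  using smash_part_deg_in[of f free_deg UNIV n] by (auto elim: smash_deg_in_mono)

text \<open>In degree n, \<open>low_iff\<close> requires the degree n part of the abelianized
  difference to have degree below n, hence to vanish. By \<open>H_ideal_0_iff\<close> this for all n
  is also equality in H_0. One direction makes the natural map well defined, the other makes it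
  injective.\<close>

lemma leading_eq_iff:
  assumes "f \<in> smash_deg_in free_deg UNIV" "g \<in> smash_deg_in free_deg UNIV"
  shows "leading f = leading g \<longleftrightarrow> H_class 0 f = H_class 0 g"
proof -
  have fg: "f - g \<in> smash_deg_in free_deg UNIV"
    by (rule smash_deg_in_diff[OF assms])
  let ?h = "smash_abelianize (f - g)"
  have homogeneous: "smash_part poly_deg n ?h \<in> smash_deg_in poly_deg {..<n} \<longleftrightarrow> smash_part poly_deg n ?h = 0" for n
  proof
    assume "smash_part poly_deg n ?h \<in> smash_deg_in poly_deg {..<n}"
    from smash_part_deg_in[OF this, of n] have "smash_part poly_deg n (smash_part poly_deg n ?h) = 0"
      by (simp add: smash_deg_in_empty)
    moreover have "smash_part poly_deg n ?h \<in> smash_deg_in poly_deg {n}"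
      using smash_part_deg_in[OF smash_abelianize_deg_in[OF fg], of n] by simp
    ultimately show "smash_part poly_deg n ?h = 0"
      using smash_part_homogeneous by fastforce
  qed simp
  have "leading f n = leading g n \<longleftrightarrow> smash_part poly_deg n ?h = 0" for n
  proof -
    have "leading f n = leading g n \<longleftrightarrow> smash_part free_deg n (f - g) \<in> low n"
      unfolding leading_def smash_part_diff
      by (rule symb_eq_iff[OF part_deg_in[OF assms(1)] part_deg_in[OF assms(2)]])
    then show ?thesis
      by (simp only: low_iff[OF part_deg_in[OF fg]] smash_abelianize_part homogeneous)
  qed
  then have "leading f = leading g \<longleftrightarrow> (\<forall>n. smash_part poly_deg n ?h = 0)"
    by (simp add: fun_eq_iff)
  then show ?thesis
    by (simp add: smash_part_eq_0_iff undeformed.H_class_eq_iff[OF assms] H_ideal_0_iff[OF fg])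
qed

lemma H_class_eq_image: "H_class l f = (\<lambda>i. i + f) ` H_ideal l"
  by (auto simp: H_class_def a_r_coset_def')

lemma H_class_self: "f \<in> H_class l f"
  using ideal_0 by (auto simp: H_class_eq_image image_iff)

lemma H_class_member:
  assumes "f \<in> smash_deg_in free_deg UNIV" "g \<in> H_class l f"
  shows "g \<in> smash_deg_in free_deg UNIV" "H_class l g = H_class l f"
proof -
  from assms(2) obtain i where i: "i \<in> H_ideal l" "g = i + f"
    by (auto simp: H_class_eq_image)
  show g: "g \<in> smash_deg_in free_deg UNIV"
    using smash_deg_in_add[OF ideal_deg_in assms(1)] i by simp
  show "H_class l g = H_class l f"
    using H_class_eq_iff[OF g assms(1)] i by simp
qed

end

context deformation
begin

interpretation FR: filtered_ring "H l" "H_filt l"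
  by (rule filtered_ring_H)

lemma gr_map_H_class:
  assumes f: "f \<in> smash_deg_in free_deg UNIV"
  shows "gr_map l (H_class 0 f) = leading f"
proof -
  have "gr_map l (H_class 0 f) = the_elem (leading ` H_class 0 f)"
    by (simp add: gr_map_def leading_def[abs_def] symb_def)
  also have "\<dots> = leading f"
  proof (rule the_elem_image_unique)
    show "H_class 0 f \<noteq> {}"
      using undeformed.H_class_self by blast
    show "leading g = leading f" if "g \<in> H_class 0 f" for g
      using undeformed.H_class_member[OF f that] leading_eq_iff[OF _ f] by simp
  qed
  finally show ?thesis .
qed

lemma leading_add:
  assumes "f \<in> smash_deg_in free_deg UNIV" "g \<in> smash_deg_in free_deg UNIV"
  shows "leading (f + g) n = leading f n \<otimes>\<^bsub>gr_comp (H l) (H_filt l) n\<^esub> leading g n"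
  by (simp add: leading_def smash_part_add symb_add part_deg_in assms)

lemma leading_mult:
  assumes f: "f \<in> smash_deg_in free_deg UNIV" and g: "g \<in> smash_deg_in free_deg UNIV"
  shows "leading (f \<otimes>\<^bsub>free_skew\<^esub> g) n = 
    finprod (gr_comp (H l) (H_filt l) n)
      (\<lambda>i. gr_mult (H l) (H_filt l) i (n - i) (leading f i) (leading g (n - i))) {..n}"
proof -
  interpret C: comm_group "gr_comp (H l) (H_filt l) n"
    by (rule FR.comm_group_gr_comp)
  let ?p = "\<lambda>i. smash_part free_deg i f \<otimes>\<^bsub>free_skew\<^esub> smash_part free_deg (n - i) g"
  have p: "?p i \<in> smash_deg_in free_deg {..n}" if "i \<le> n" for i
    by (rule free_skew_mult_deg_in[OF part_deg_in[OF f] part_deg_in[OF g]]) (use that in auto)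
  have "finprod (gr_comp (H l) (H_filt l) n)
      (\<lambda>i. gr_mult (H l) (H_filt l) i (n - i) (leading f i) (leading g (n - i))) {..n} =
    finprod (gr_comp (H l) (H_filt l) n) (\<lambda>i. symb n (?p i)) {..n}"
    using p by (intro C.finprod_cong')
      (auto simp: leading_def symb_mult[OF part_deg_in[OF f] part_deg_in[OF g]] carrier_gr_comp_H)
  also have "\<dots> = symb n (sum ?p {..n})"
    by (rule C.finprod_additive[where S = "smash_deg_in free_deg {..n}"])
       (use p in \<open>auto simp: carrier_gr_comp_H smash_deg_in_add symb_0 symb_add\<close>)
  finally show ?thesis
    by (simp add: leading_def smash_part_mult[OF f g])
qed

text \<open>This identifies the map as the natural one on homogeneous elements; compatibility with
  the unit and the scalars is its case of degree 0.\<close>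

lemma leading_homogeneous:
  assumes "f \<in> smash_deg_in free_deg {n}"
  shows "leading f = gr_symbol (H l) (H_filt l) n (H_class l f)"
proof
  fix m
  show "leading f m = gr_symbol (H l) (H_filt l) n (H_class l f) m"
    by (cases "m = n")
       (simp_all add: leading_def gr_symbol_def smash_part_homogeneous[OF assms] symb_0, simp add: symb_def)
qed

lemma leading_in_carrier:
  assumes f: "f \<in> smash_deg_in free_deg UNIV"
  shows "leading f \<in> carrier (gr_H l)"
proof -
  obtain N where "f \<in> smash_deg_in free_deg {..N}"
    using smash_deg_in_bounded[OF f] .
  then have "smash_part free_deg n f = 0" if "n > N" for n
    using smash_part_deg_in[of f free_deg "{..N}" n] that by (auto simp: smash_deg_in_empty)
  then have "leading f n = \<one>\<^bsub>gr_comp (H l) (H_filt l) n\<^esub>" if "n > N" for n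
    using that by (simp add: leading_def symb_0)
  then have "{n. leading f n \<noteq> \<one>\<^bsub>gr_comp (H l) (H_filt l) n\<^esub>} \<subseteq> {..N}"
    by (auto simp flip: not_less)
  then show ?thesis
    using finite_subset part_deg_in[OF f]
    by (auto simp: gr_H_def FR.carrier_gr carrier_gr_comp_H leading_def)
qed

lemma leading_surj:
  assumes "a \<in> carrier (gr_H l)"
  obtains f where "f \<in> smash_deg_in free_deg UNIV" "a = leading f"
proof -
  have "\<forall>n. \<exists>h \<in> smash_deg_in free_deg {..n}. a n = symb n h"
    using assms by (auto simp: gr_H_def FR.carrier_gr carrier_gr_comp_H)
  then obtain h where h: "h n \<in> smash_deg_in free_deg {..n}" "a n = symb n (h n)" for n
    by metis
  define S where "S = {n. a n \<noteq> \<one>\<^bsub>gr_comp (H l) (H_filt l) n\<^esub>}"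
  have "finite S"
    using assms by (simp add: gr_H_def FR.carrier_gr S_def)
  \<comment> \<open>A representative \<open>h n\<close> may contain terms of lower degree. They do
    not affect its class in degree n but would disturb the other components, so only its degree n
    part enters the sum.\<close>
  define f where "f = (\<Sum>n\<in>S. smash_part free_deg n (h n))"
  have part: "smash_part free_deg n (h n) \<in> smash_deg_in free_deg {n}" for n
    by (rule smash_deg_in_mono[OF smash_part_deg_in[OF h(1)]]) simp
  have "smash_part free_deg m f = (if m \<in> S then smash_part free_deg m (h m) else 0)" for m
  proof -
    have "smash_part free_deg m f = (\<Sum>n\<in>S. smash_part free_deg m (smash_part free_deg n (h n)))"
      unfolding f_def by (induction S rule: infinite_finite_induct) (simp_all add: smash_part_add)
    also have "\<dots> = (\<Sum>n\<in>S. if n = m then smash_part free_deg m (h m) else 0)"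
      by (intro sum.cong refl) (auto simp: smash_part_homogeneous[OF part])
    finally show ?thesis using \<open>finite S\<close> by simp
  qed
  moreover have "symb m (smash_part free_deg m (h m)) = a m" for m
  proof -
    have "h m - smash_part free_deg m (h m) \<in> low m"
      by (intro deg_in_low smash_part_top h)
    then show ?thesis
      using symb_eq_iff[OF h(1) part] by (metis h(2))
  qed
  ultimately have "a m = leading f m" for m
    by (cases "m \<in> S") (simp_all add: leading_def, simp add: S_def symb_0)
  then have "a = leading f" ..
  moreover have "f \<in> smash_deg_in free_deg UNIV"
    unfolding f_def by (intro smash_deg_in_sum smash_deg_in_mono[OF part]) simp
  ultimately show ?thesis using that by blast
qed

end

section \<open>The natural map as an isomorphism of graded algebras\<close>

lemma H0_simps:
  "carrier H0 = H_class 0 ` smash_deg_in free_deg UNIV" "mult H0 = mult (H 0)" "add H0 = add (H 0)"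
  "\<one>\<^bsub>H0\<^esub> = H_class 0 (Poly_Mapping.single (mat 1) 1)" "scalar H0 c = H_class 0 (smash_scalar c)"
  "piece H0 n = H_class 0 ` smash_deg_in free_deg {n}"
  by (simp_all add: H0_def with_grading_def undeformed.carrier_H undeformed.H_class_one H_scalar_def smash_piece_eq)

lemma smash_scalar_deg_in: "d 0 = 0 \<Longrightarrow> smash_scalar c \<in> smash_deg_in d {0}"
  by (simp add: smash_scalar_def smash_deg_in_single deg_in_const)

lemma smash_one_eq_scalar: "Poly_Mapping.single (mat 1) 1 = smash_scalar 1"
  by (simp add: smash_scalar_def)

lemma smash_deg_in_UNIV_I: "f \<in> smash_deg_in d S \<Longrightarrow> f \<in> smash_deg_in d UNIV"
  by (erule smash_deg_in_mono) simp

lemma smash_mult_UNIV: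
  "f \<in> smash_deg_in free_deg UNIV \<Longrightarrow> g \<in> smash_deg_in free_deg UNIV \<Longrightarrow>
     f \<otimes>\<^bsub>free_skew\<^esub> g \<in> smash_deg_in free_deg UNIV"
  by (erule (1) free_skew_mult_deg_in) simp

context deformation
begin

interpretation FR: filtered_ring "H l" "H_filt l"
  by (rule filtered_ring_H)

lemma gr_simps:
  "mult (gr_H l) a b = (\<lambda>n. finprod (gr_comp (H l) (H_filt l) n)
      (\<lambda>i. gr_mult (H l) (H_filt l) i (n - i) (a i) (b (n - i))) {..n})"
  "add (gr_H l) a b = (\<lambda>n. a n \<otimes>\<^bsub>gr_comp (H l) (H_filt l) n\<^esub> b n)"
  "\<one>\<^bsub>gr_H l\<^esub> = gr_symbol (H l) (H_filt l) 0 \<one>\<^bsub>H l\<^esub>"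
  "scalar (gr_H l) c = gr_symbol (H l) (H_filt l) 0 (H_scalar l c)"
  "piece (gr_H l) n = {a \<in> carrier (gr_H l). \<forall>m. m \<noteq> n \<longrightarrow> a m = \<one>\<^bsub>gr_comp (H l) (H_filt l) m\<^esub>}"
  by (simp_all add: gr_H_def gr_def fun_eq_iff)

theorem gr_map_iso: "gr_map l \<in> graded_algebra_iso H0 (gr_H l)"
proof -
  have "gr_map l \<in> ring_iso H0 (gr_H l)"
  proof (rule ring_iso_memI)
    show "gr_map l x \<in> carrier (gr_H l)" if "x \<in> carrier H0" for x
      using that by (auto simp: H0_simps gr_map_H_class leading_in_carrier)
    show "gr_map l (x \<otimes>\<^bsub>H0\<^esub> y) = gr_map l x \<otimes>\<^bsub>gr_H l\<^esub> gr_map l y" if xy: "x \<in> carrier H0" "y \<in> carrier H0" for x y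
    proof -
      from xy obtain f g where "x = H_class 0 f" "y = H_class 0 g"
        "f \<in> smash_deg_in free_deg UNIV" "g \<in> smash_deg_in free_deg UNIV"
        by (auto simp: H0_simps)
      then show ?thesis
        by (simp add: H0_simps gr_simps gr_map_H_class smash_mult_UNIV leading_mult fun_eq_iff
            flip: undeformed.H_class_mult)
    qed
    show "gr_map l (x \<oplus>\<^bsub>H0\<^esub> y) = gr_map l x \<oplus>\<^bsub>gr_H l\<^esub> gr_map l y" if xy: "x \<in> carrier H0" "y \<in> carrier H0" for x y
    proof -
      from xy obtain f g where "x = H_class 0 f" "y = H_class 0 g"
        "f \<in> smash_deg_in free_deg UNIV" "g \<in> smash_deg_in free_deg UNIV"
        by (auto simp: H0_simps)
      then show ?thesis
        by (simp add: H0_simps gr_simps gr_map_H_class smash_deg_in_add leading_add fun_eq_iff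
            flip: undeformed.H_class_add)
    qed
    show "gr_map l \<one>\<^bsub>H0\<^esub> = \<one>\<^bsub>gr_H l\<^esub>"
      using smash_scalar_deg_in[of free_deg "1 :: 'k"]
      by (simp add: H0_simps gr_simps smash_one_eq_scalar gr_map_H_class smash_deg_in_UNIV_I leading_homogeneous
          flip: H_class_one)
    show "bij_betw (gr_map l) (carrier H0) (carrier (gr_H l))"
    proof (rule bij_betw_imageI)
      show "inj_on (gr_map l) (carrier H0)"
        by (auto simp: inj_on_def H0_simps gr_map_H_class leading_eq_iff)
      show "gr_map l ` carrier H0 = carrier (gr_H l)"
        by (auto simp: H0_simps image_image gr_map_H_class leading_in_carrier elim!: leading_surj)
    qed
  qed
  moreover have "gr_map l (scalar H0 c) = scalar (gr_H l) c" for c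
    using smash_scalar_deg_in[of free_deg c]
    by (simp add: H0_simps gr_simps H_scalar_def gr_map_H_class smash_deg_in_UNIV_I leading_homogeneous)
  moreover have "gr_map l ` piece H0 n = piece (gr_H l) n" for n
  proof
    show "gr_map l ` piece H0 n \<subseteq> piece (gr_H l) n"
    proof
      fix a
      assume "a \<in> gr_map l ` piece H0 n"
      then obtain f where "f \<in> smash_deg_in free_deg {n}" "a = leading f"
        by (auto simp: H0_simps gr_map_H_class smash_deg_in_UNIV_I)
      then show "a \<in> piece (gr_H l) n"
        using leading_in_carrier[OF smash_deg_in_UNIV_I]
        by (simp add: gr_simps) (simp add: leading_homogeneous gr_symbol_def)
    qed
    show "piece (gr_H l) n \<subseteq> gr_map l ` piece H0 n"
    proof
      fix a
      assume a: "a \<in> piece (gr_H l) n"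
      then obtain f where f: "f \<in> smash_deg_in free_deg UNIV" "a = leading f"
        by (auto simp: gr_simps elim: leading_surj)
      \<comment> \<open>The preimage f need not be homogeneous. Its degree n part has the same image
        because all other components of \<open>a\<close> are trivial.\<close>
      have g: "smash_part free_deg n f \<in> smash_deg_in free_deg {n}"
        using smash_part_deg_in[OF f(1), of n] by simp
      have "leading (smash_part free_deg n f) m = a m" for m
        using a by (auto simp: gr_simps leading_def smash_part_homogeneous[OF g] symb_0 f(2))
      then have "a = gr_map l (H_class 0 (smash_part free_deg n f))"
        by (simp add: gr_map_H_class smash_deg_in_UNIV_I[OF g] fun_eq_iff)
      then show "a \<in> gr_map l ` piece H0 n"
        using g by (auto simp: H0_simps)
    qed
  qed
  ultimately show ?thesis
    by (simp add: graded_algebra_iso_def)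
qed

end

section \<open>Comparison of H_0 with the polynomial skew group algebra\<close>

lemma poly_map_H_class:
  assumes f: "f \<in> smash_deg_in free_deg UNIV"
  shows "poly_map (H_class 0 f) = smash_abelianize f"
proof -
  have "smash_abelianize g = smash_abelianize f" if "g \<in> H_class 0 f" for g
  proof -
    have "g - f \<in> H_ideal 0"
      using undeformed.H_class_eq_iff[of g UNIV f UNIV] undeformed.H_class_member[OF f that] f by simp
    then show ?thesis
      using H_ideal_0_iff[OF undeformed.ideal_deg_in[of "g - f"]] by (simp add: smash_abelianize_diff)
  qed
  moreover have "H_class 0 f \<noteq> {}"
    using undeformed.H_class_self by blast
  ultimately show ?thesis
    unfolding poly_map_def by (intro the_elem_image_unique)
qed

lemma poly_skew_simps:
  "carrier poly_skew = smash_deg_in poly_deg UNIV" "mult poly_skew = mult (smash_product G poly_act)"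
  "add poly_skew = (+)" "\<one>\<^bsub>poly_skew\<^esub> = smash_scalar 1" "scalar poly_skew = smash_scalar"
  "piece poly_skew n = smash_deg_in poly_deg {n}"
  by (simp_all add: poly_skew_def with_grading_def smash_deg_in_UNIV smash_piece_eq smash_one_eq_scalar)

lemma smash_abelianize_scalar: "smash_abelianize (smash_scalar c) = smash_scalar c"
  by (rule poly_mapping_eqI) (simp add: smash_scalar_def lookup_map lookup_single when_def)

lemma smash_abelianize_image:
  "smash_abelianize ` smash_deg_in free_deg S = (smash_deg_in poly_deg S :: 'k::field poly_smash set)"
proof (intro equalityI subsetI)
  fix q :: "'k poly_smash"
  assume "q \<in> smash_deg_in poly_deg S"
  then show "q \<in> smash_abelianize ` smash_deg_in free_deg S"
    by (intro image_eqI[where x = "smash_normal_lift q"])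
       (simp_all only: smash_abelianize_normal_lift smash_normal_lift_deg_in)
qed (auto simp: smash_abelianize_deg_in)

text \<open>Injectivity is \<open>H_ideal_0_iff\<close>; surjectivity, degree by degree, comes from
  the section \<open>smash_normal_lift\<close>, which preserves degrees.\<close>

theorem poly_map_iso:
  "poly_map \<in> graded_algebra_iso H0 (poly_skew :: ('k::field, 'k poly_smash) graded_algebra)"
proof -
  have "poly_map \<in> ring_iso H0 (poly_skew :: ('k, 'k poly_smash) graded_algebra)"
  proof (rule ring_iso_memI)
    fix x y :: "'k free_smash set"
    assume "x \<in> carrier H0" "y \<in> carrier H0"
    then obtain f g where "x = H_class 0 f" "y = H_class 0 g"
        "f \<in> smash_deg_in free_deg UNIV" "g \<in> smash_deg_in free_deg UNIV"
      by (auto simp: H0_simps)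
    then show "poly_map (x \<otimes>\<^bsub>H0\<^esub> y) = poly_map x \<otimes>\<^bsub>poly_skew\<^esub> poly_map y"
      "poly_map (x \<oplus>\<^bsub>H0\<^esub> y) = poly_map x \<oplus>\<^bsub>poly_skew\<^esub> poly_map y"
      by (simp_all add: H0_simps poly_skew_simps poly_map_H_class smash_mult_UNIV smash_deg_in_add
          smash_abelianize_mult smash_abelianize_add flip: undeformed.H_class_mult undeformed.H_class_add)
  next
    show "poly_map x \<in> carrier poly_skew" if "x \<in> carrier H0" for x :: "'k free_smash set"
      using that by (auto simp: H0_simps poly_skew_simps poly_map_H_class smash_abelianize_deg_in)
    show "poly_map \<one>\<^bsub>H0\<^esub> = \<one>\<^bsub>poly_skew :: ('k, 'k poly_smash) graded_algebra\<^esub>"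
      using smash_scalar_deg_in[of free_deg "1 :: 'k"]
      by (simp add: H0_simps poly_skew_simps smash_one_eq_scalar poly_map_H_class smash_deg_in_UNIV_I smash_abelianize_scalar)
    show "bij_betw poly_map (carrier H0) (carrier (poly_skew :: ('k, 'k poly_smash) graded_algebra))"
    proof (rule bij_betw_imageI)
      show "inj_on poly_map (carrier (H0 :: ('k, 'k free_smash set) graded_algebra))"
        by (auto simp: inj_on_def H0_simps poly_map_H_class undeformed.H_class_eq_iff H_ideal_0_iff
            smash_deg_in_diff smash_abelianize_diff)
      show "poly_map ` carrier H0 = carrier (poly_skew :: ('k, 'k poly_smash) graded_algebra)"
        by (simp add: H0_simps image_image poly_map_H_class poly_skew_simps smash_abelianize_image)
    qed
  qed
  moreover have "poly_map (scalar H0 c) = scalar poly_skew c" for c :: 'k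
    using smash_scalar_deg_in[of free_deg c]
    by (simp add: H0_simps poly_skew_simps poly_map_H_class smash_deg_in_UNIV_I smash_abelianize_scalar)
  moreover have "poly_map ` piece H0 n = piece (poly_skew :: ('k, 'k poly_smash) graded_algebra) n" for n
    by (simp add: H0_simps image_image poly_map_H_class smash_deg_in_UNIV_I poly_skew_simps smash_abelianize_image)
  ultimately show ?thesis
    by (simp add: graded_algebra_iso_def)
qed

theorem theorem2p2:
  fixes p :: nat and lam :: "'k::alg_closed_field^2^2 \<Rightarrow>\<^sub>0 'k"
  assumes "prime p" and "odd p" and "CHAR('k) = p"
    and "lam \<in> group_algebra G"
  shows "gr_map lam \<in> graded_algebra_iso H0 (gr_H lam)
       \<and> (\<forall>n. \<forall>f \<in> smash_piece free_deg n.
            gr_map lam (H_class 0 f) = gr_symbol (H lam) (H_filt lam) n (H_class lam f))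
       \<and> poly_map \<in> graded_algebra_iso H0 (poly_skew :: ('k, 'k poly_smash) graded_algebra)
       \<and> (\<forall>f \<in> carrier (free_skew :: 'k free_smash ring).
            poly_map (H_class 0 f) = Poly_Mapping.map abelianize f)"
proof -
  interpret deformation lam
    by standard (rule assms(4))
  have "gr_map lam (H_class 0 f) = gr_symbol (H lam) (H_filt lam) n (H_class lam f)"
    if "f \<in> smash_piece free_deg n" for n f
    using that by (simp add: smash_piece_eq gr_map_H_class smash_deg_in_UNIV_I leading_homogeneous)
  then show ?thesis
    using gr_map_iso poly_map_iso by (auto simp: poly_map_H_class smash_deg_in_UNIV)
qed

end
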